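(* The limit (short wave) system of the 3-Novikov system, $$u_t+(upr)_x=0,\quad v_t+3vp_xr+v_xpr+u^2p=0,\quad w_t+3wpr_x+w_xpr-u^2r=0,\quad v=-p_{xx},\ w=-r_{xx},$$ admits a bi-Hamiltonian structure and a Lax pair, as follows. (1) It can be written as $$\begin{pmatrix} u \\ v \\ w \end{pmatrix}_t=\bar{\mathcal J}_1\begin{pmatrix}\delta\bar H_2/\delta u\\ \delta\bar H_2/\delta v\\ \delta\bar H_2/\delta w\end{pmatrix}=\bar{\mathcal K}_1\begin{pmatrix}\delta\bar H_1/\delta u\\ \delta\bar H_1/\delta v\\ \delta\bar H_1/\delta w\end{pmatrix},$$ where $$\bar{\mathcal J}_1=\begin{pmatrix}\tfrac12\partial&0&0\\ 0&0&-\partial^2\\ 0&\partial^2&0\end{pmatrix},\quad \bar{\mathcal K}_1=\begin{pmatrix}0&0&0\\ 0&\tfrac32v\partial^{-1}v&-u^2-\tfrac32v\partial^{-1}w\\ 0&u^2-\tfrac32w\partial^{-1}v&\tfrac32w\partial^{-1}w\end{pmatrix}-2\,\Omega\,\partial^{-3}\,\Omega^{*},$$ $$\Omega=(\partial u,\ \tfrac12v\partial+\partial v,\ \tfrac12w\partial+\partial w)^T,\qquad \bar H_1=\int p_xr_x\,dx,\qquad \bar H_2=\int\left(pp_xrr_{xx}+pp_xr_x^2-u^2pr\right)dx.$$ (2) It has the Lax pair, with spectral parameter $\lambda$, $$\varphi_x=\begin{pmatrix}0&1&0\\ \lambda u^2&0&v\\ \lambda w&0&0\end{pmatrix}\varphi,\qquad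 \varphi_t=\begin{pmatrix}\frac1{3\lambda}+pr_x&-pr&\frac p\lambda\\ p_xr_x-\lambda u^2pr&\frac1{3\lambda}-p_xr&\frac{p_x}\lambda-vpr\\ -\lambda wpr-r_x&r&p_xr-pr_x-\frac2{3\lambda}\end{pmatrix}\varphi .$$
   Context: $\partial=\partial_x$; products such as $\partial u$ denote operator composition; $\Omega^*=(-u\partial,\,-\tfrac12\partial v-v\partial,\,-\tfrac12\partial w-w\partial)$ is the formal adjoint of $\Omega$; $\partial^{-1},\partial^{-3}$ are formal inverses with zero integration constants ($\partial^{-1}f_x=f$, $\partial^{-3}f_{xxx}=f$). $\bar H_1,\bar H_2$ are functionals of $(u,v,w)$ through $p=-\partial^{-2}v$, $r=-\partial^{-2}w$, and integrals of total $x$-derivatives are zero. "Lax pair" means that the system is the compatibility condition $U_t-V_x+UV-VU=0$ (for all $\lambda\ne0$) of $\varphi_x=U\varphi$, $\varphi_t=V\varphi$. *)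

theory Defs
  imports "HOL-Analysis.Analysis"
begin

section \<open>Partial derivatives and the system\<close>

text \<open>Space-time points are pairs \<open>(x, t)\<close>.\<close>

definition Dx :: "(real \<times> real \<Rightarrow> real) \<Rightarrow> real \<times> real \<Rightarrow> real" where
  "Dx f = (\<lambda>(x, t). deriv (\<lambda>y. f (y, t)) x)"

definition Dt :: "(real \<times> real \<Rightarrow> real) \<Rightarrow> real \<times> real \<Rightarrow> real" where
  "Dt f = (\<lambda>(x, t). deriv (\<lambda>s. f (x, s)) t)"

text \<open>\<open>C\<^sup>\<infinity>\<close> on an open set: all iterated partial derivatives, in any order, are
  (Frechet) differentiable.\<close>

definition C_inf_on :: "(real \<times> real) set \<Rightarrow> (real \<times> real \<Rightarrow> real) \<Rightarrow> bool" where
  "C_inf_on D f \<longleftrightarrow>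
     (\<forall>ds. set ds \<subseteq> {Dx, Dt} \<longrightarrow> foldr (\<lambda>d g. d g) ds f differentiable_on D)"

definition potentials ::
  "(real \<times> real) set \<Rightarrow> (real \<times> real \<Rightarrow> real) \<Rightarrow> (real \<times> real \<Rightarrow> real) \<Rightarrow>
     (real \<times> real \<Rightarrow> real) \<Rightarrow> (real \<times> real \<Rightarrow> real) \<Rightarrow> bool" where
  "potentials D v w p r \<longleftrightarrow> (\<forall>z\<in>D. v z = - Dx (Dx p) z \<and> w z = - Dx (Dx r) z)"

definition limit_system ::
  "(real \<times> real) set \<Rightarrow> (real \<times> real \<Rightarrow> real) \<Rightarrow> (real \<times> real \<Rightarrow> real) \<Rightarrow>
     (real \<times> real \<Rightarrow> real) \<Rightarrow> (real \<times> real \<Rightarrow> real) \<Rightarrow> (real \<times> real \<Rightarrow> real) \<Rightarrow> bool" where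
  "limit_system D u v w p r \<longleftrightarrow>
     (\<forall>z\<in>D.
        Dt u z + Dx (\<lambda>y. u y * p y * r y) z = 0 \<and>
        Dt v z + 3 * v z * Dx p z * r z + Dx v z * p z * r z + (u z)\<^sup>2 * p z = 0 \<and>
        Dt w z + 3 * w z * p z * Dx r z + Dx w z * p z * r z - (u z)\<^sup>2 * r z = 0) \<and>
     potentials D v w p r"


section \<open>Function spaces on the line and the formal inverses of the derivative\<close>

definition schwartz :: "(real \<Rightarrow> real) set" where
  "schwartz = {f. (\<forall>n x. (deriv ^^ n) f differentiable at x) \<and>
                  (\<forall>m n. bounded (range (\<lambda>x. x ^ m * (deriv ^^ n) f x)))}"

text \<open>The operator \<open>\<partial>\<close> to the power \<open>-n\<close>, for \<open>n \<ge> 1\<close>: convolution with the fundamental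
  solution \<open>sgn x * x ^ (n - 1) / (2 * (n - 1)!)\<close> of \<open>\<partial>\<close> to the power \<open>n\<close>. This is the choice
  of integration constants for which, on rapidly decreasing \<open>f\<close>, the \<open>n\<close>-th derivative of
  \<open>pinv n f\<close> is \<open>f\<close>, \<open>pinv n\<close> of the \<open>n\<close>-th derivative of \<open>f\<close> is \<open>f\<close>, and \<open>pinv n\<close> is
  symmetric for even \<open>n\<close> and skew-symmetric for odd \<open>n\<close>.\<close>

definition pinv :: "nat \<Rightarrow> (real \<Rightarrow> real) \<Rightarrow> real \<Rightarrow> real" where
  "pinv n f x = (LBINT y. sgn (x - y) * (x - y) ^ (n - 1) / (2 * fact (n - 1)) * f y)"

type_synonym field3 = "real \<Rightarrow> real ^ 3"

definition vec3 :: "(real \<Rightarrow> real) \<Rightarrow> (real \<Rightarrow> real) \<Rightarrow> (real \<Rightarrow> real) \<Rightarrow> field3" where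
  "vec3 a b c = (\<lambda>x. vector [a x, b x, c x])"

definition comp :: "field3 \<Rightarrow> 3 \<Rightarrow> real \<Rightarrow> real" where
  "comp U i = (\<lambda>x. U x $ i)"

definition pairing :: "field3 \<Rightarrow> field3 \<Rightarrow> real" where
  "pairing \<xi> \<eta> = (LBINT x. \<xi> x \<bullet> \<eta> x)"

definition schwartz3 :: "field3 set" where
  "schwartz3 = {vec3 a b c | a b c. a \<in> schwartz \<and> b \<in> schwartz \<and> c \<in> schwartz}"

text \<open>The states \<open>(u, v, w)\<close> at which \<open>p = -\<partial>\<^sup>-\<^sup>2 v\<close> and \<open>r = -\<partial>\<^sup>-\<^sup>2 w\<close> are rapidly decreasing. This is
  a linear space, so it is also the space of admissible variations of a state.\<close>

definition states :: "field3 set" where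
  "states = {vec3 u (\<lambda>x. - deriv (deriv p) x) (\<lambda>x. - deriv (deriv r) x) | u p r.
               u \<in> schwartz \<and> p \<in> schwartz \<and> r \<in> schwartz}"

text \<open>Variational derivatives live in the following space. Since \<open>p = -\<partial>\<^sup>-\<^sup>2 v\<close> one has
  \<open>\<delta>H/\<delta>v = -\<partial>\<^sup>-\<^sup>2 (\<delta>H/\<delta>p)\<close>, which need not decay; likewise for \<open>w\<close>. Against variations
  in \<open>states\<close> the last two components would otherwise be determined only up to affine
  functions of \<open>x\<close>; taking them in the range of \<open>pinv 2\<close> is the zero integration constants
  convention.\<close>

definition covectors :: "field3 set" where
  "covectors = {vec3 a (pinv 2 b) (pinv 2 c) | a b c.
                  a \<in> schwartz \<and> b \<in> schwartz \<and> c \<in> schwartz}"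


section \<open>Functionals and variational derivatives\<close>

definition has_var_deriv :: "(field3 \<Rightarrow> real) \<Rightarrow> field3 \<Rightarrow> field3 \<Rightarrow> bool" where
  "has_var_deriv H U g \<longleftrightarrow> g \<in> covectors \<and>
     (\<forall>\<phi>\<in>states. ((\<lambda>\<epsilon>. H (\<lambda>x. U x + \<epsilon> *\<^sub>R \<phi> x)) has_real_derivative pairing g \<phi>) (at 0))"

definition var_deriv :: "(field3 \<Rightarrow> real) \<Rightarrow> field3 \<Rightarrow> field3" where
  "var_deriv H U = (THE g. has_var_deriv H U g)"

definition p_of :: "field3 \<Rightarrow> real \<Rightarrow> real" where
  "p_of U = (\<lambda>x. - pinv 2 (comp U 2) x)"

definition r_of :: "field3 \<Rightarrow> real \<Rightarrow> real" where
  "r_of U = (\<lambda>x. - pinv 2 (comp U 3) x)"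

definition H1 :: "field3 \<Rightarrow> real" where
  "H1 U = (LBINT x. deriv (p_of U) x * deriv (r_of U) x)"

definition H2 :: "field3 \<Rightarrow> real" where
  "H2 U = (let u = comp U 1; p = p_of U; r = r_of U in
     LBINT x. p x * deriv p x * r x * deriv (deriv r) x + p x * deriv p x * (deriv r x)\<^sup>2
              - (u x)\<^sup>2 * p x * r x)"


section \<open>Hamiltonian operators\<close>

text \<open>A (state-dependent) operator \<open>P U\<close>, with domain \<open>\<D> U\<close> of covectors, is Hamiltonian if it
  is skew-symmetric and its bracket satisfies the Jacobi identity, written out as the vanishing
  of the cyclic sum of the terms \<open>\<langle>\<xi>, P'(U)[P(U) \<eta>] \<zeta>\<rangle>\<close>, \<open>P'(U)[h]\<close> being the derivative of
  \<open>P\<close> at \<open>U\<close> in the direction \<open>h\<close>.\<close>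

type_synonym operator3 = "field3 \<Rightarrow> field3 \<Rightarrow> field3"

definition dir_deriv :: "operator3 \<Rightarrow> field3 \<Rightarrow> field3 \<Rightarrow> field3 \<Rightarrow> field3" where
  "dir_deriv P U h \<zeta> =
     (\<lambda>x. vector_derivative (\<lambda>\<epsilon>. P (\<lambda>y. U y + \<epsilon> *\<^sub>R h y) \<zeta> x) (at 0))"

definition hamiltonian_operator :: "(field3 \<Rightarrow> field3 set) \<Rightarrow> operator3 \<Rightarrow> bool" where
  "hamiltonian_operator \<D> P \<longleftrightarrow> (\<forall>U\<in>schwartz3.
     (\<forall>\<xi>\<in>\<D> U. \<forall>\<eta>\<in>\<D> U. pairing \<xi> (P U \<eta>) = - pairing \<eta> (P U \<xi>)) \<and>
     (\<forall>\<xi>\<in>\<D> U. \<forall>\<eta>\<in>\<D> U. \<forall>\<zeta>\<in>\<D> U.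
        pairing \<xi> (dir_deriv P U (P U \<eta>) \<zeta>) +
        pairing \<eta> (dir_deriv P U (P U \<zeta>) \<xi>) +
        pairing \<zeta> (dir_deriv P U (P U \<xi>) \<eta>) = 0))"

definition bi_hamiltonian_pair ::
  "(field3 \<Rightarrow> field3 set) \<Rightarrow> operator3 \<Rightarrow> (field3 \<Rightarrow> field3 set) \<Rightarrow> operator3 \<Rightarrow> bool" where
  "bi_hamiltonian_pair \<D>P P \<D>Q Q \<longleftrightarrow>
     hamiltonian_operator \<D>P P \<and> hamiltonian_operator \<D>Q Q \<and>
     (\<forall>a b. hamiltonian_operator (\<lambda>U. \<D>P U \<inter> \<D>Q U)
              (\<lambda>U \<xi> x. a *\<^sub>R P U \<xi> x + b *\<^sub>R Q U \<xi> x))"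

definition J1 :: operator3 where
  "J1 U \<xi> = vec3 (\<lambda>x. 1/2 * deriv (comp \<xi> 1) x)
                  (\<lambda>x. - deriv (deriv (comp \<xi> 3)) x)
                  (\<lambda>x. deriv (deriv (comp \<xi> 2)) x)"

definition Omega :: "field3 \<Rightarrow> (real \<Rightarrow> real) \<Rightarrow> field3" where
  "Omega U f = (let u = comp U 1; v = comp U 2; w = comp U 3 in
     vec3 (deriv (\<lambda>x. u x * f x))
          (\<lambda>x. 1/2 * v x * deriv f x + deriv (\<lambda>y. v y * f y) x)
          (\<lambda>x. 1/2 * w x * deriv f x + deriv (\<lambda>y. w y * f y) x))"

definition Omega_adj :: "field3 \<Rightarrow> field3 \<Rightarrow> real \<Rightarrow> real" where
  "Omega_adj U \<xi> = (let u = comp U 1; v = comp U 2; w = comp U 3;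
                        a = comp \<xi> 1; b = comp \<xi> 2; c = comp \<xi> 3 in
     (\<lambda>x. - u x * deriv a x
          - 1/2 * deriv (\<lambda>y. v y * b y) x - v x * deriv b x
          - 1/2 * deriv (\<lambda>y. w y * c y) x - w x * deriv c x))"

definition K1 :: operator3 where
  "K1 U \<xi> = (let u = comp U 1; v = comp U 2; w = comp U 3;
                 b = comp \<xi> 2; c = comp \<xi> 3;
                 vb = pinv 1 (\<lambda>y. v y * b y); wc = pinv 1 (\<lambda>y. w y * c y) in
     (\<lambda>x. vec3 (\<lambda>x. 0)
               (\<lambda>x. 3/2 * v x * vb x - (u x)\<^sup>2 * c x - 3/2 * v x * wc x)
               (\<lambda>x. (u x)\<^sup>2 * b x - 3/2 * w x * vb x + 3/2 * w x * wc x) x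
          - 2 *\<^sub>R Omega U (pinv 3 (Omega_adj U \<xi>)) x))"

text \<open>Formally, \<open>\<partial>\<^sup>-\<^sup>1\<close> and \<open>\<partial>\<^sup>-\<^sup>3\<close> act on derivatives and third derivatives. The domain of
  \<open>K1 U\<close> is accordingly the set of covectors \<open>(a, b, c)\<close> for which \<open>v b - w c\<close> (the only
  combination to which \<open>\<partial>\<^sup>-\<^sup>1\<close> is applied) and \<open>\<Omega>\<^sup>* (a, b, c)\<close> are a first and a third derivative
  of rapidly decreasing functions. Without it, the integrals of the total derivatives that
  make up the Jacobi identity would have boundary contributions.\<close>

definition K1_domain :: "field3 \<Rightarrow> field3 set" where
  "K1_domain U = {\<xi> \<in> covectors.
     (\<exists>f\<in>schwartz. (\<lambda>x. comp U 2 x * comp \<xi> 2 x - comp U 3 x * comp \<xi> 3 x) = deriv f) \<and>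
     (\<exists>f\<in>schwartz. Omega_adj U \<xi> = (deriv ^^ 3) f)}"

definition state_at ::
  "(real \<times> real \<Rightarrow> real) \<Rightarrow> (real \<times> real \<Rightarrow> real) \<Rightarrow> (real \<times> real \<Rightarrow> real) \<Rightarrow> real \<Rightarrow> field3" where
  "state_at u v w t = vec3 (\<lambda>x. u (x, t)) (\<lambda>x. v (x, t)) (\<lambda>x. w (x, t))"

text \<open>The evolution equation \<open>(u, v, w)\<^sub>t = P (\<delta>H/\<delta>u, \<delta>H/\<delta>v, \<delta>H/\<delta>w)\<close> at the times in \<open>T\<close>.
  \<open>T\<close> may be any set of times, even a single instant: the flow need not keep \<open>p\<close> and \<open>r\<close>
  rapidly decreasing, so conditions on the state are only imposed at the times in \<open>T\<close>.\<close>

definition hamiltonian_flow ::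
  "operator3 \<Rightarrow> (field3 \<Rightarrow> real) \<Rightarrow> real set \<Rightarrow> (real \<times> real \<Rightarrow> real) \<Rightarrow>
     (real \<times> real \<Rightarrow> real) \<Rightarrow> (real \<times> real \<Rightarrow> real) \<Rightarrow> bool" where
  "hamiltonian_flow P H T u v w \<longleftrightarrow>
     (\<forall>t\<in>T. state_at (Dt u) (Dt v) (Dt w) t =
              P (state_at u v w t) (var_deriv H (state_at u v w t)))"


section \<open>Lax pairs\<close>

text \<open>The compatibility condition of \<open>\<phi>\<^sub>x = A \<phi>\<close>, \<open>\<phi>\<^sub>t = B \<phi>\<close>.\<close>

definition zero_curvature ::
  "(real \<times> real) set \<Rightarrow> (real \<times> real \<Rightarrow> complex ^ 3 ^ 3) \<Rightarrow>
     (real \<times> real \<Rightarrow> complex ^ 3 ^ 3) \<Rightarrow> bool" where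
  "zero_curvature D A B \<longleftrightarrow> (\<forall>(x, t)\<in>D.
     vector_derivative (\<lambda>s. A (x, s)) (at t) - vector_derivative (\<lambda>y. B (y, t)) (at x)
     + A (x, t) ** B (x, t) - B (x, t) ** A (x, t) = 0)"

definition is_Lax_pair ::
  "(real \<times> real) set \<Rightarrow> bool \<Rightarrow> (complex \<Rightarrow> real \<times> real \<Rightarrow> complex ^ 3 ^ 3) \<Rightarrow>
     (complex \<Rightarrow> real \<times> real \<Rightarrow> complex ^ 3 ^ 3) \<Rightarrow> bool" where
  "is_Lax_pair D system A B \<longleftrightarrow> (system \<longleftrightarrow> (\<forall>l. l \<noteq> 0 \<longrightarrow> zero_curvature D (A l) (B l)))"

definition Lax_U ::
  "(real \<times> real \<Rightarrow> real) \<Rightarrow> (real \<times> real \<Rightarrow> real) \<Rightarrow> (real \<times> real \<Rightarrow> real) \<Rightarrow>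
     complex \<Rightarrow> real \<times> real \<Rightarrow> complex ^ 3 ^ 3" where
  "Lax_U u v w l z = (let u = complex_of_real (u z); v = complex_of_real (v z);
                          w = complex_of_real (w z) in
     vector [vector [0, 1, 0],
             vector [l * u\<^sup>2, 0, v],
             vector [l * w, 0, 0]])"

definition Lax_V ::
  "(real \<times> real \<Rightarrow> real) \<Rightarrow> (real \<times> real \<Rightarrow> real) \<Rightarrow> (real \<times> real \<Rightarrow> real) \<Rightarrow>
     (real \<times> real \<Rightarrow> real) \<Rightarrow> (real \<times> real \<Rightarrow> real) \<Rightarrow>
     complex \<Rightarrow> real \<times> real \<Rightarrow> complex ^ 3 ^ 3" where
  "Lax_V u v w p r l z =
     (let px = complex_of_real (Dx p z); rx = complex_of_real (Dx r z);
          u = complex_of_real (u z); v = complex_of_real (v z); w = complex_of_real (w z);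
          p = complex_of_real (p z); r = complex_of_real (r z) in
     vector [vector [1 / (3 * l) + p * rx, - p * r, p / l],
             vector [px * rx - l * u\<^sup>2 * p * r, 1 / (3 * l) - px * r, px / l - v * p * r],
             vector [- l * w * p * r - rx, r, px * r - p * rx - 2 / (3 * l)]])"

end

theory Submission
  imports Defs "HOL-Probability.Sinc_Integral"
begin

text \<open>On a covector \<open>\<xi> = (a, b, c)\<close> in the domain of \<open>K1\<close> write \<open>v b - w c = \<partial>F\<close> and
  \<open>\<Omega>\<^sup>* \<xi> = \<partial>\<^sup>3 f\<close> with \<open>F\<close> and \<open>f\<close> rapidly decreasing, so that \<open>K1 \<xi>\<close> becomes a local expression
  in \<open>u, v, w, b, c, F, f\<close>. The derivative of \<open>K1\<close> in a direction \<open>h\<close> still contains \<open>\<partial>\<^sup>-\<^sup>1\<close> and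
  \<open>\<partial>\<^sup>-\<^sup>3\<close> of terms in \<open>h\<close>; paired with a covector of the domain, these are moved by parts onto \<open>F\<close>
  and \<open>f\<close>. Each term of the Jacobi identity is then the integral of a local density that is linear
  in \<open>h\<close>, and for both \<open>h = K1 \<eta>\<close> and \<open>h = J1 \<eta>\<close> the cyclic sum of the densities is the derivative of
  an explicit rapidly decreasing function. The first case is the Jacobi identity for \<open>K1\<close>, the second
  its compatibility with \<open>J1\<close>.

  In the Lax pair, comparing powers of \<open>\<lambda>\<close> gives the system, except that the equation for \<open>u\<close>
  only appears multiplied by \<open>u\<close>. If it failed at a point, it would fail on a neighbourhood, where
  then \<open>u = 0\<close>; but there it holds.\<close>

section \<open>Rapidly decreasing and polynomially bounded smooth functions\<close>

text \<open>The obstacle is that covectors do not decay: \<open>pinv 2\<close> of a Schwartz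
  function generally grows linearly, so integrating by parts against b or c is safe only if another
  factor decays. Hence two function classes: the smooth functions of polynomial growth form an
  algebra in which the Schwartz functions are an ideal, and the densities and potentials for
  \<open>K1\<close> have a Schwartz factor in every term. The decay of F and f makes this possible;
  \<open>pinv 1\<close> and \<open>pinv 3\<close> of terms in h have in general only polynomial
  growth, which is why they must disappear from the pairing. Where a potential would lack a decaying
  factor, as for \<open>J1\<close>, the symmetry of \<open>pinv 2\<close> replaces integration by
  parts. Since \<open>J1\<close> does not depend on the state, the cyclic sum for the combination
  \<alpha> \<open>J1\<close> + \<beta> \<open>K1\<close> is \<beta> (\<alpha> S + \<beta> S'), with
  S coming from directions \<open>J1\<close> and S' from directions \<open>K1\<close>; all weights
  are therefore treated at once. Derivatives in a parameter are never exchanged with integrals: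
  along a line in the space of states \<open>K1\<close> and both functionals are polynomials in the
  parameter.\<close>

definition rapid :: "(real \<Rightarrow> real) \<Rightarrow> bool" where
  "rapid f \<longleftrightarrow> (\<forall>m. bounded (range (\<lambda>x. x ^ m * f x)))"

text \<open>The weight 1 + x^2 is at least 1, so its powers increase with the exponent and bounds of
  different degrees can be combined; with powers of |x| this would fail near 0.\<close>

definition polybounded :: "(real \<Rightarrow> real) \<Rightarrow> bool" where
  "polybounded f \<longleftrightarrow> (\<exists>C m. \<forall>x. \<bar>f x\<bar> \<le> C * (1 + x\<^sup>2) ^ m)"

definition tempered :: "(real \<Rightarrow> real) set" where
  "tempered = {f. (\<forall>n x. (deriv ^^ n) f differentiable at x) \<and> (\<forall>n. polybounded ((deriv ^^ n) f))}"

lemma schwartz_iff_rapid: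
  "f \<in> schwartz \<longleftrightarrow> (\<forall>n x. (deriv ^^ n) f differentiable at x) \<and> (\<forall>n. rapid ((deriv ^^ n) f))"
  unfolding schwartz_def rapid_def by blast

lemma rapid_add: "rapid f \<Longrightarrow> rapid g \<Longrightarrow> rapid (\<lambda>x. f x + g x)"
  unfolding rapid_def by (auto simp: distrib_left intro!: bounded_plus_comp)

lemma rapid_mult_id: "rapid f \<Longrightarrow> rapid (\<lambda>x. x * f x)"
  unfolding rapid_def
proof
  fix m assume "\<forall>m. bounded (range (\<lambda>x. x ^ m * f x))"
  then have "bounded (range (\<lambda>x. x ^ Suc m * f x))" by blast
  then show "bounded (range (\<lambda>x. x ^ m * (x * f x)))" by (simp add: mult_ac)
qed

lemma rapid_weight: "rapid f \<Longrightarrow> rapid (\<lambda>x. (1 + x\<^sup>2) ^ m * f x)"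
proof (induction m)
  case (Suc m)
  let ?g = "\<lambda>x. (1 + x\<^sup>2) ^ m * f x"
  have "rapid (\<lambda>x. ?g x + x * (x * ?g x))"
    using Suc by (intro rapid_add rapid_mult_id) auto
  then show ?case by (simp add: power2_eq_square algebra_simps)
qed simp

lemma rapid_weight_bound:
  assumes "rapid f"
  obtains C where "\<And>x. (1 + x\<^sup>2) ^ m * \<bar>f x\<bar> \<le> C"
proof -
  have "bounded (range (\<lambda>x. x ^ 0 * ((1 + x\<^sup>2) ^ m * f x)))"
    using rapid_weight[OF assms, of m] unfolding rapid_def by blast
  then obtain C where "\<And>x. \<bar>(1 + x\<^sup>2) ^ m * f x\<bar> \<le> C"
    by (auto simp: bounded_iff)
  then have "(1 + x\<^sup>2) ^ m * \<bar>f x\<bar> \<le> C" for x by (simp add: abs_mult)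
  then show thesis using that by blast
qed

lemma rapidI_weight:
  assumes "\<And>m. \<exists>C. \<forall>x. (1 + x\<^sup>2) ^ m * \<bar>f x\<bar> \<le> C"
  shows "rapid f"
  unfolding rapid_def
proof
  fix m
  obtain C where C: "\<And>x. (1 + x\<^sup>2) ^ m * \<bar>f x\<bar> \<le> C" using assms[of m] by blast
  have "norm (x ^ m * f x) \<le> C" for x
  proof -
    have "0 \<le> (\<bar>x\<bar> - 1)\<^sup>2" by simp
    then have "2 * \<bar>x\<bar> \<le> 1 + x\<^sup>2" by (simp add: power2_eq_square algebra_simps)
    then have "\<bar>x\<bar> \<le> 1 + x\<^sup>2" using abs_ge_zero[of x] by linarith
    then have "\<bar>x\<bar> ^ m \<le> (1 + x\<^sup>2) ^ m" by (intro power_mono) auto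
    then have "\<bar>x\<bar> ^ m * \<bar>f x\<bar> \<le> (1 + x\<^sup>2) ^ m * \<bar>f x\<bar>" by (intro mult_right_mono) auto
    with C[of x] show ?thesis by (simp add: abs_mult power_abs)
  qed
  then show "bounded (range (\<lambda>x. x ^ m * f x))" by (auto simp: bounded_iff)
qed

lemma rapid_mult:
  assumes "rapid f" "polybounded g"
  shows "rapid (\<lambda>x. f x * g x)"
proof (rule rapidI_weight)
  fix m
  obtain C k where g: "\<And>x. \<bar>g x\<bar> \<le> C * (1 + x\<^sup>2) ^ k"
    using assms(2) unfolding polybounded_def by blast
  \<comment> \<open>The growth of g, of degree k in the weight, is paid for by k further orders of
    decay of f.\<close>
  obtain B where B: "\<And>x. (1 + x\<^sup>2) ^ (m + k) * \<bar>f x\<bar> \<le> B"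
    using rapid_weight_bound[OF assms(1)] by metis
  have "(1 + x\<^sup>2) ^ m * \<bar>f x * g x\<bar> \<le> \<bar>C\<bar> * B" for x
  proof -
    have "\<bar>g x\<bar> \<le> \<bar>C\<bar> * (1 + x\<^sup>2) ^ k"
      using g[of x] by (rule order_trans) (intro mult_right_mono, auto)
    then have "(1 + x\<^sup>2) ^ m * \<bar>f x\<bar> * \<bar>g x\<bar> \<le> (1 + x\<^sup>2) ^ m * \<bar>f x\<bar> * (\<bar>C\<bar> * (1 + x\<^sup>2) ^ k)"
      by (intro mult_left_mono) auto
    also have "\<dots> = \<bar>C\<bar> * ((1 + x\<^sup>2) ^ (m + k) * \<bar>f x\<bar>)" by (simp add: power_add)
    also have "\<dots> \<le> \<bar>C\<bar> * B" by (intro mult_left_mono B) auto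
    finally show ?thesis by (simp add: abs_mult)
  qed
  then show "\<exists>C. \<forall>x. (1 + x\<^sup>2) ^ m * \<bar>f x * g x\<bar> \<le> C" by blast
qed

lemma rapid_imp_polybounded: "rapid f \<Longrightarrow> polybounded f"
  using rapid_weight_bound[of f 0] unfolding polybounded_def
  by (metis mult.commute mult.left_neutral power_0)

lemma polybounded_add:
  assumes "polybounded f" "polybounded g"
  shows "polybounded (\<lambda>x. f x + g x)"
proof -
  obtain C k where f: "\<And>x. \<bar>f x\<bar> \<le> C * (1 + x\<^sup>2) ^ k"
    using assms(1) unfolding polybounded_def by blast
  obtain B m where g: "\<And>x. \<bar>g x\<bar> \<le> B * (1 + x\<^sup>2) ^ m"
    using assms(2) unfolding polybounded_def by blast
  have "\<bar>f x + g x\<bar> \<le> (\<bar>C\<bar> + \<bar>B\<bar>) * (1 + x\<^sup>2) ^ (k + m)" for x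
  proof -
    have "C * (1 + x\<^sup>2) ^ k \<le> \<bar>C\<bar> * (1 + x\<^sup>2) ^ (k + m)"
      by (intro mult_mono power_increasing) auto
    moreover have "B * (1 + x\<^sup>2) ^ m \<le> \<bar>B\<bar> * (1 + x\<^sup>2) ^ (k + m)"
      by (intro mult_mono power_increasing) auto
    ultimately show ?thesis
      using f[of x] g[of x] abs_triangle_ineq[of "f x" "g x"] by (simp add: distrib_right)
  qed
  then show ?thesis unfolding polybounded_def by blast
qed

lemma polybounded_mult:
  assumes "polybounded f" "polybounded g"
  shows "polybounded (\<lambda>x. f x * g x)"
proof -
  obtain C k where f: "\<And>x. \<bar>f x\<bar> \<le> C * (1 + x\<^sup>2) ^ k"
    using assms(1) unfolding polybounded_def by blast
  obtain B m where g: "\<And>x. \<bar>g x\<bar> \<le> B * (1 + x\<^sup>2) ^ m"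
    using assms(2) unfolding polybounded_def by blast
  have "\<bar>f x * g x\<bar> \<le> (C * B) * (1 + x\<^sup>2) ^ (k + m)" for x
  proof -
    have "0 \<le> C * (1 + x\<^sup>2) ^ k" using f[of x] by linarith
    then have "\<bar>f x\<bar> * \<bar>g x\<bar> \<le> (C * (1 + x\<^sup>2) ^ k) * (B * (1 + x\<^sup>2) ^ m)"
      by (intro mult_mono f g) auto
    then show ?thesis by (simp add: abs_mult power_add mult_ac)
  qed
  then show ?thesis unfolding polybounded_def by blast
qed

text \<open>A coinduction rule: a class of functions closed under \<open>deriv\<close>, all of whose
  members have the order-zero properties, lies in \<open>tempered\<close>. It avoids higher-order
  Leibniz formulas.\<close>

lemma temperedI:
  assumes "P f"
    and step: "\<And>f. P f \<Longrightarrow> (\<forall>x. f differentiable at x) \<and> polybounded f \<and> P (deriv f)"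
  shows "f \<in> tempered"
proof -
  have "P ((deriv ^^ n) f)" for n
    using assms by (induction n) auto
  then show ?thesis using step unfolding tempered_def by blast
qed

lemma schwartzI:
  assumes "P f"
    and step: "\<And>f. P f \<Longrightarrow> (\<forall>x. f differentiable at x) \<and> rapid f \<and> P (deriv f)"
  shows "f \<in> schwartz"
proof -
  have "P ((deriv ^^ n) f)" for n
    using assms by (induction n) auto
  then show ?thesis using step unfolding schwartz_iff_rapid by blast
qed

lemma tempered_D:
  assumes "f \<in> tempered"
  shows "f differentiable at x" "polybounded f" "deriv f \<in> tempered"
proof -
  show "f differentiable at x" "polybounded f"
    using assms funpow_0[of deriv f] unfolding tempered_def by (metis (mono_tags, lifting) mem_Collect_eq)+
  have "(deriv ^^ Suc n) f differentiable at x \<and> polybounded ((deriv ^^ Suc n) f)" for n x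
    using assms unfolding tempered_def by blast
  then show "deriv f \<in> tempered" unfolding tempered_def funpow_Suc_right by auto
qed

lemma schwartz_D:
  assumes "f \<in> schwartz"
  shows "f differentiable at x" "rapid f" "deriv f \<in> schwartz"
proof -
  show "f differentiable at x" "rapid f"
    using assms funpow_0[of deriv f] unfolding schwartz_iff_rapid by metis+
  have "(deriv ^^ Suc n) f differentiable at x \<and> rapid ((deriv ^^ Suc n) f)" for n x
    using assms unfolding schwartz_iff_rapid by blast
  then show "deriv f \<in> schwartz" unfolding schwartz_iff_rapid funpow_Suc_right by auto
qed

lemma schwartz_imp_tempered: "f \<in> schwartz \<Longrightarrow> f \<in> tempered"
  by (rule temperedI[of "\<lambda>f. f \<in> schwartz"]) (auto simp: schwartz_D rapid_imp_polybounded)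

lemma tempered_DERIV: "f \<in> tempered \<Longrightarrow> (f has_real_derivative deriv f x) (at x)"
  by (simp add: DERIV_deriv_iff_real_differentiable tempered_D)

lemma schwartz_DERIV: "f \<in> schwartz \<Longrightarrow> (f has_real_derivative deriv f x) (at x)"
  by (simp add: DERIV_deriv_iff_real_differentiable schwartz_D)

lemma tempered_const: "(\<lambda>x. c) \<in> tempered"
proof (rule temperedI[of "\<lambda>f. \<exists>c. f = (\<lambda>x. c)"])
  fix f :: "real \<Rightarrow> real" assume "\<exists>c. f = (\<lambda>x. c)"
  then obtain c where f: "f = (\<lambda>x. c)" by blast
  have "polybounded f"
    unfolding polybounded_def f by (rule exI[of _ "\<bar>c\<bar>"], rule exI[of _ 0]) auto
  then show "(\<forall>x. f differentiable at x) \<and> polybounded f \<and> (\<exists>c. deriv f = (\<lambda>x. c))"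
    using f by auto
qed auto

text \<open>The derivative of a product is a sum of products, so products alone are not closed under
  \<open>deriv\<close>; the algebra generated by \<open>tempered\<close> is, and
  \<open>temperedI\<close> applies to it.\<close>

inductive_set tempered_alg :: "(real \<Rightarrow> real) set" where
  "f \<in> tempered \<Longrightarrow> f \<in> tempered_alg"
| "f \<in> tempered_alg \<Longrightarrow> g \<in> tempered_alg \<Longrightarrow> (\<lambda>x. f x + g x) \<in> tempered_alg"
| "f \<in> tempered_alg \<Longrightarrow> g \<in> tempered_alg \<Longrightarrow> (\<lambda>x. f x * g x) \<in> tempered_alg"

lemma deriv_add_fun:
  "(\<And>x. f differentiable at x) \<Longrightarrow> (\<And>x. g differentiable at x) \<Longrightarrow>
    deriv (\<lambda>x. f x + g x :: real) = (\<lambda>x. deriv f x + deriv g x)"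
  by (rule ext, rule DERIV_imp_deriv, rule DERIV_add)
     (auto simp: DERIV_deriv_iff_real_differentiable)

lemma deriv_mult_fun:
  "(\<And>x. f differentiable at x) \<Longrightarrow> (\<And>x. g differentiable at x) \<Longrightarrow>
    deriv (\<lambda>x. f x * g x :: real) = (\<lambda>x. f x * deriv g x + deriv f x * g x)"
  by (rule ext, rule DERIV_imp_deriv, rule DERIV_mult')
     (auto simp: DERIV_deriv_iff_real_differentiable)

lemma tempered_alg_subset: "f \<in> tempered_alg \<Longrightarrow> f \<in> tempered"
proof (erule temperedI)
  fix f assume "f \<in> tempered_alg"
  then show "(\<forall>x. f differentiable at x) \<and> polybounded f \<and> deriv f \<in> tempered_alg"
  proof induction
    case (1 f)
    then show ?case by (auto simp: tempered_D intro: tempered_alg.intros)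
  next
    case (2 f g)
    then show ?case
      by (auto simp: deriv_add_fun polybounded_add intro: tempered_alg.intros)
  next
    case (3 f g)
    then show ?case
      by (auto simp: deriv_mult_fun polybounded_mult intro!: tempered_alg.intros(2,3))
  qed
qed

lemma tempered_add: "f \<in> tempered \<Longrightarrow> g \<in> tempered \<Longrightarrow> (\<lambda>x. f x + g x) \<in> tempered"
  and tempered_mult: "f \<in> tempered \<Longrightarrow> g \<in> tempered \<Longrightarrow> (\<lambda>x. f x * g x) \<in> tempered"
  by (auto intro!: tempered_alg_subset intro: tempered_alg.intros)

lemma tempered_uminus: "f \<in> tempered \<Longrightarrow> (\<lambda>x. - f x) \<in> tempered"
  using tempered_mult[OF tempered_const[of "-1"], of f] by simp

lemma tempered_diff: "f \<in> tempered \<Longrightarrow> g \<in> tempered \<Longrightarrow> (\<lambda>x. f x - g x) \<in> tempered"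
  using tempered_add[OF _ tempered_uminus[of g], of f] by simp

lemma tempered_power: "f \<in> tempered \<Longrightarrow> (\<lambda>x. f x ^ n) \<in> tempered"
  by (induction n) (auto intro: tempered_const tempered_mult)

text \<open>Growth has to be checked for f alone, since all its derivatives are g or derivatives of
  g. This is how the identity function and \<open>pinv 1\<close> enter the class.\<close>

lemma tempered_antideriv:
  assumes "\<And>x. (f has_real_derivative g x) (at x)" "polybounded f" "g \<in> tempered"
  shows "f \<in> tempered"
proof (rule temperedI[of "\<lambda>h. h = f \<or> h \<in> tempered"])
  have "deriv f = g" using assms(1) by (intro ext DERIV_imp_deriv)
  moreover have "f differentiable at x" for x using assms(1) real_differentiable_def by blast
  ultimately show "(\<forall>x. h differentiable at x) \<and> polybounded h \<and> (deriv h = f \<or> deriv h \<in> tempered)"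
    if "h = f \<or> h \<in> tempered" for h
    using that assms(2,3) tempered_D[of h] by blast
qed simp

lemma tempered_id: "(\<lambda>x. x) \<in> tempered"
proof (rule tempered_antideriv[OF _ _ tempered_const[of 1]])
  have "\<bar>x\<bar> \<le> 1 * (1 + x\<^sup>2) ^ 1" for x :: real
  proof -
    have "0 \<le> (\<bar>x\<bar> - 1)\<^sup>2" by simp
    then have "2 * \<bar>x\<bar> \<le> 1 + x\<^sup>2" by (simp add: power2_eq_square algebra_simps)
    then show ?thesis using abs_ge_zero[of x] by (simp del: abs_ge_zero)
  qed
  then show "polybounded (\<lambda>x. x)" unfolding polybounded_def by blast
qed (auto intro!: derivative_eq_intros)

text \<open>The ideal property by the same coinduction: in f' g + f g' each summand still has a
  Schwartz factor.\<close>

inductive_set schwartz_ideal :: "(real \<Rightarrow> real) set" where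
  "f \<in> schwartz \<Longrightarrow> g \<in> tempered \<Longrightarrow> (\<lambda>x. f x * g x) \<in> schwartz_ideal"
| "f \<in> schwartz_ideal \<Longrightarrow> g \<in> schwartz_ideal \<Longrightarrow> (\<lambda>x. f x + g x) \<in> schwartz_ideal"

lemma schwartz_ideal_subset: "f \<in> schwartz_ideal \<Longrightarrow> f \<in> schwartz"
proof (erule schwartzI)
  fix f assume "f \<in> schwartz_ideal"
  then show "(\<forall>x. f differentiable at x) \<and> rapid f \<and> deriv f \<in> schwartz_ideal"
  proof induction
    case (1 f g)
    then show ?case
      by (auto simp: deriv_mult_fun tempered_D schwartz_D rapid_mult intro!: schwartz_ideal.intros)
  next
    case (2 f g)
    then show ?case
      by (auto simp: deriv_add_fun rapid_add intro: schwartz_ideal.intros)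
  qed
qed

lemma schwartz_mult: "f \<in> schwartz \<Longrightarrow> g \<in> tempered \<Longrightarrow> (\<lambda>x. f x * g x) \<in> schwartz"
  by (auto intro!: schwartz_ideal_subset intro: schwartz_ideal.intros)

lemma schwartz_cmult: "f \<in> schwartz \<Longrightarrow> (\<lambda>x. c * f x) \<in> schwartz"
  using schwartz_mult[OF _ tempered_const[of c], of f] by (simp add: mult.commute)

lemma schwartz_add:
  assumes "f \<in> schwartz" "g \<in> schwartz"
  shows "(\<lambda>x. f x + g x) \<in> schwartz"
proof -
  have "(\<lambda>x. f x * 1 + g x * 1) \<in> schwartz"
    by (rule schwartz_ideal_subset) (intro schwartz_ideal.intros assms tempered_const)
  then show ?thesis by simp
qed

lemma schwartz_uminus: "f \<in> schwartz \<Longrightarrow> (\<lambda>x. - f x) \<in> schwartz"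
  using schwartz_cmult[of f "-1"] by simp

lemma schwartz_diff: "f \<in> schwartz \<Longrightarrow> g \<in> schwartz \<Longrightarrow> (\<lambda>x. f x - g x) \<in> schwartz"
  using schwartz_add[OF _ schwartz_uminus[of g], of f] by simp

lemma schwartz_zero: "(\<lambda>x. 0) \<in> schwartz"
  by (rule schwartzI[of "\<lambda>f. f = (\<lambda>x. 0)"]) (auto simp: rapid_def)

lemma schwartz_power:
  assumes "f \<in> schwartz" "0 < n"
  shows "(\<lambda>x. f x ^ n) \<in> schwartz"
  using assms schwartz_mult[OF assms(1) tempered_power[OF schwartz_imp_tempered[OF assms(1)], of "n - 1"]]
  by (cases n) auto

lemma schwartz_deriv: "f \<in> schwartz \<Longrightarrow> (\<lambda>x. deriv f x) \<in> schwartz"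
  and tempered_deriv: "f \<in> tempered \<Longrightarrow> (\<lambda>x. deriv f x) \<in> tempered"
  by (auto simp: schwartz_D tempered_D)

text \<open>As introduction rules these need a Schwartz factor at the head of each product.\<close>

lemmas schwartz_intros = schwartz_zero schwartz_deriv schwartz_add schwartz_diff schwartz_uminus
  schwartz_cmult schwartz_power schwartz_mult
lemmas tempered_intros = tempered_const tempered_id tempered_deriv tempered_add tempered_diff
  tempered_uminus tempered_power tempered_mult


section \<open>Integration\<close>

lemma schwartz_continuous: "f \<in> schwartz \<Longrightarrow> isCont f x"
  using DERIV_isCont schwartz_DERIV by blast

lemma schwartz_continuous_on: "f \<in> schwartz \<Longrightarrow> continuous_on S f"
  by (simp add: continuous_at_imp_continuous_on schwartz_continuous)

lemma schwartz_measurable: "f \<in> schwartz \<Longrightarrow> f \<in> borel_measurable borel"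
  by (rule borel_measurable_continuous_onI) (rule schwartz_continuous_on)

lemma schwartz_integrable:
  assumes "f \<in> schwartz"
  shows "integrable lborel f"
proof -
  obtain C where C: "\<And>x. (1 + x\<^sup>2) ^ 1 * \<bar>f x\<bar> \<le> C"
    using rapid_weight_bound[OF schwartz_D(2)[OF assms]] by metis
  have "integrable lborel (\<lambda>x::real. inverse (1 + x\<^sup>2))"
    using integrable_inverse_1_plus_square by (simp add: set_integrable_def)
  then have "integrable lborel (\<lambda>x. C * inverse (1 + x\<^sup>2))" by simp
  then show ?thesis
  proof (rule Bochner_Integration.integrable_bound)
    show "f \<in> borel_measurable lborel" using schwartz_measurable[OF assms] by simp
    have "\<bar>f x\<bar> \<le> C / (1 + x\<^sup>2)" for x
      using C[of x] by (simp add: field_simps add_pos_nonneg)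
    then have "\<bar>f x\<bar> \<le> \<bar>C / (1 + x\<^sup>2)\<bar>" for x
      by (meson abs_ge_self order_trans)
    then show "AE x in lborel. norm (f x) \<le> norm (C * inverse (1 + x\<^sup>2))"
      by (simp add: divide_inverse)
  qed
qed

lemma schwartz_tendsto_0:
  assumes "f \<in> schwartz"
  shows "(f \<longlongrightarrow> 0) at_top" "(f \<longlongrightarrow> 0) at_bot"
proof -
  obtain C where C: "\<And>x. (1 + x\<^sup>2) ^ 1 * \<bar>f x\<bar> \<le> C"
    using rapid_weight_bound[OF schwartz_D(2)[OF assms]] by metis
  have le: "norm (f x) \<le> C * inverse (1 + x\<^sup>2)" for x
    using C[of x] by (simp add: field_simps add_pos_nonneg)
  have top: "LIM x at_top. 1 + (x::real)\<^sup>2 :> at_top"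
    by (rule filterlim_tendsto_add_at_top[OF tendsto_const filterlim_pow_at_top[OF _ filterlim_ident]]) simp
  then have bot: "LIM x at_bot. 1 + (x::real)\<^sup>2 :> at_top"
    by (subst filterlim_at_bot_mirror) simp
  have "((\<lambda>x. C * inverse (1 + x\<^sup>2)) \<longlongrightarrow> 0) at_top"
    using tendsto_mult[OF tendsto_const[of C] tendsto_inverse_0_at_top[OF top]] by simp
  then show "(f \<longlongrightarrow> 0) at_top"
    by (rule Lim_null_comparison[OF always_eventually, rotated]) (use le in auto)
  have "((\<lambda>x. C * inverse (1 + x\<^sup>2)) \<longlongrightarrow> 0) at_bot"
    using tendsto_mult[OF tendsto_const[of C] tendsto_inverse_0_at_top[OF bot]] by simp
  then show "(f \<longlongrightarrow> 0) at_bot"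
    by (rule Lim_null_comparison[OF always_eventually, rotated]) (use le in auto)
qed

text \<open>The limits are left arbitrary because in \<open>pinv2_symmetric\<close> the potential
  tends to a common value at both ends that need not be 0.\<close>

lemma integral_total_derivative:
  fixes G g :: "real \<Rightarrow> real"
  assumes "\<And>x. (G has_real_derivative g x) (at x)" "\<And>x. isCont g x" "integrable lborel g"
    and "(G \<longlongrightarrow> A) at_bot" "(G \<longlongrightarrow> B) at_top"
  shows "(LBINT x. g x) = B - A"
proof -
  have "(LBINT x=-\<infinity>..\<infinity>. g x) = B - A"
    using assms
    by (intro interval_integral_FTC_integrable)
       (auto simp: has_real_derivative_iff_has_vector_derivative set_integrable_def ereal_tendsto_simps)
  then show ?thesis by (simp add: interval_integral_to_infinity_eq interval_lebesgue_integral_def set_lebesgue_integral_def)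
qed

lemma integral_schwartz_deriv:
  assumes "\<And>x. (G has_real_derivative g x) (at x)" "G \<in> schwartz"
  shows "(LBINT x. g x) = 0"
proof -
  have g: "g = deriv G" using assms(1) by (metis DERIV_imp_deriv ext)
  show ?thesis
    using integral_total_derivative[OF assms(1), of 0 0] assms(2)
    by (simp add: g schwartz_D schwartz_continuous schwartz_integrable schwartz_tendsto_0)
qed

text \<open>Integration by parts in the form used throughout: a whole chain of partial integrations
  is packed into one potential G, and only a pointwise identity remains to be checked.\<close>

lemma integral_eq_mod_deriv:
  assumes "f \<in> schwartz" "g \<in> schwartz" "G \<in> schwartz"
    and "\<And>x. (G has_real_derivative f x - g x) (at x)"
  shows "(LBINT x. f x) = (LBINT x. g x)"
proof -
  have "(LBINT x. f x - g x) = 0" by (rule integral_schwartz_deriv[OF assms(4,3)])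
  moreover have "(LBINT x. f x - g x) = (LBINT x. f x) - (LBINT x. g x)"
    by (intro Bochner_Integration.integral_diff schwartz_integrable assms)
  ultimately show ?thesis by simp
qed

section \<open>Inverse derivatives\<close>

lemma kernel_integrable:
  assumes "f \<in> schwartz"
  shows "integrable lborel (\<lambda>y. sgn (x - y) * (x - y) ^ (n - 1) / (2 * fact (n - 1)) * f y)"
proof -
  have g: "(\<lambda>y. f y * ((x - y) ^ (n - 1) * (1 / (2 * fact (n - 1))))) \<in> schwartz"
    by (intro schwartz_mult tempered_intros assms)
  have "f \<in> borel_measurable borel" by (rule schwartz_measurable[OF assms])
  then have m: "(\<lambda>y. sgn (x - y) * (x - y) ^ (n - 1) / (2 * fact (n - 1)) * f y) \<in> borel_measurable lborel"
    by measurable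
  show ?thesis
    by (rule Bochner_Integration.integrable_bound[OF schwartz_integrable[OF g] m], rule AE_I2)
       (auto simp: abs_mult abs_sgn_eq mult.commute)
qed

lemma pinv_add:
  assumes "f \<in> schwartz" "g \<in> schwartz"
  shows "pinv n (\<lambda>x. f x + g x) x = pinv n f x + pinv n g x"
  unfolding pinv_def distrib_left
  by (intro Bochner_Integration.integral_add kernel_integrable assms)

lemma pinv_cmult: "pinv n (\<lambda>x. c * f x) x = c * pinv n f x"
  unfolding pinv_def
  by (subst Bochner_Integration.integral_mult_right_zero[symmetric]) (simp add: mult_ac)

lemma pinv_diff:
  assumes "f \<in> schwartz" "g \<in> schwartz"
  shows "pinv n (\<lambda>x. f x - g x) x = pinv n f x - pinv n g x"
  using pinv_add[OF assms(1) schwartz_cmult[OF assms(2), of "-1"], of n x] pinv_cmult[of n "-1" g x]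
  by simp

lemma pinv_uminus: "pinv n (\<lambda>x. - f x) x = - pinv n f x"
  using pinv_cmult[of n "-1" f x] by simp

lemma pinv1_eq: "pinv 1 f x = (LBINT y. sgn (x - y) / 2 * f y)"
  by (simp add: pinv_def)

lemma kernel1_integrable: "f \<in> schwartz \<Longrightarrow> integrable lborel (\<lambda>y. sgn (x - y) / 2 * f y)"
  using kernel_integrable[of f x 1] by simp

lemma integral_lincomb:
  fixes f g :: "real \<Rightarrow> real"
  assumes "integrable lborel f" "integrable lborel g"
  shows "(LBINT y. a * f y + b * g y) = a * (LBINT y. f y) + b * (LBINT y. g y)"
  using assms by simp

text \<open>Expanding x - y in the kernel separates the variables, so that questions about
  \<open>pinv 2\<close> become questions about \<open>pinv 1\<close> of f and of its first moment y
  f; \<open>pinv3_eq\<close> does the same with the square.\<close>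

lemma pinv2_eq:
  assumes "f \<in> schwartz"
  shows "pinv 2 f x = x * pinv 1 f x - pinv 1 (\<lambda>y. y * f y) x"
proof -
  have yf: "(\<lambda>y. y * f y) \<in> schwartz"
    using schwartz_mult[OF assms tempered_id] by (simp add: mult.commute)
  have "pinv 2 f x = (LBINT y. x * (sgn (x - y) / 2 * f y) + (- 1) * (sgn (x - y) / 2 * (y * f y)))"
    unfolding pinv_def by (rule Bochner_Integration.integral_cong) (auto simp: field_simps)
  also have "\<dots> = x * pinv 1 f x + (- 1) * pinv 1 (\<lambda>y. y * f y) x"
    unfolding pinv1_eq by (intro integral_lincomb kernel1_integrable assms yf)
  finally show ?thesis by simp
qed

lemma pinv3_eq:
  assumes "f \<in> schwartz"
  shows "pinv 3 f x = (x\<^sup>2 * pinv 1 f x - 2 * x * pinv 1 (\<lambda>y. y * f y) x + pinv 1 (\<lambda>y. y\<^sup>2 * f y) x) / 2"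
proof -
  have yf: "(\<lambda>y. y * f y) \<in> schwartz"
    using schwartz_mult[OF assms tempered_id] by (simp add: mult.commute)
  have yyf: "(\<lambda>y. y\<^sup>2 * f y) \<in> schwartz"
    using schwartz_mult[OF assms tempered_power[OF tempered_id]] by (simp add: mult.commute)
  \<comment> \<open>The factor 1 gives the integrand the shape a f + b g that
    \<open>integral_lincomb\<close> expects.\<close>
  have "pinv 3 f x = (LBINT y. 1 * (x\<^sup>2 / 2 * (sgn (x - y) / 2 * f y) + (- x) * (sgn (x - y) / 2 * (y * f y)))
      + 1 / 2 * (sgn (x - y) / 2 * (y\<^sup>2 * f y)))"
    unfolding pinv_def
    by (rule Bochner_Integration.integral_cong) (auto simp: field_simps power2_eq_square fact_numeral)
  also have "\<dots> = 1 * (LBINT y. x\<^sup>2 / 2 * (sgn (x - y) / 2 * f y) + (- x) * (sgn (x - y) / 2 * (y * f y)))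
      + 1 / 2 * pinv 1 (\<lambda>y. y\<^sup>2 * f y) x"
    unfolding pinv1_eq
    by (intro integral_lincomb kernel1_integrable Bochner_Integration.integrable_add integrable_mult_right assms yf yyf)
  also have "(LBINT y. x\<^sup>2 / 2 * (sgn (x - y) / 2 * f y) + (- x) * (sgn (x - y) / 2 * (y * f y)))
      = x\<^sup>2 / 2 * pinv 1 f x + (- x) * pinv 1 (\<lambda>y. y * f y) x"
    unfolding pinv1_eq by (intro integral_lincomb kernel1_integrable assms yf)
  finally show ?thesis by (simp add: algebra_simps diff_divide_distrib add_divide_distrib)
qed

lemma pinv1_increment:
  assumes "f \<in> schwartz" "a \<le> x"
  shows "pinv 1 f x - pinv 1 f a = integral {a..x} f"
proof -
  have i: "integrable lborel (\<lambda>y. sgn (z - y) / 2 * f y)" for z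
    using kernel_integrable[OF assms(1), of z 1] by simp
  have "set_integrable lborel {a..x} f"
    by (intro borel_integrable_atLeastAtMost' schwartz_continuous_on assms)
  have "pinv 1 f x - pinv 1 f a = (LBINT y. sgn (x - y) / 2 * f y - sgn (a - y) / 2 * f y)"
    unfolding pinv1_eq by (rule Bochner_Integration.integral_diff[symmetric]) (rule i)+
  also have "\<dots> = (LBINT y. indicator {a..x} y *\<^sub>R f y)"
  proof (rule Bochner_Integration.integral_cong_AE)
    show "(\<lambda>y. sgn (x - y) / 2 * f y - sgn (a - y) / 2 * f y) \<in> borel_measurable lborel"
      using i[of x] i[of a] by (intro borel_measurable_diff borel_measurable_integrable)
    show "(\<lambda>y. indicator {a..x} y *\<^sub>R f y) \<in> borel_measurable lborel"
      using schwartz_measurable[OF assms(1)] by measurable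
    \<comment> \<open>The difference of the two kernels is the indicator function only off the
      endpoints, because sgn 0 = 0.\<close>
    have "AE y in lborel. y \<noteq> a \<and> y \<noteq> x" using AE_lborel_singleton[of a] AE_lborel_singleton[of x] by auto
    then show "AE y in lborel. sgn (x - y) / 2 * f y - sgn (a - y) / 2 * f y = indicator {a..x} y *\<^sub>R f y"
      by eventually_elim (use assms(2) in \<open>auto simp: sgn_if indicator_def\<close>)
  qed
  also have "\<dots> = integral {a..x} f"
    using set_borel_integral_eq_integral(2)[OF \<open>set_integrable lborel {a..x} f\<close>]
    by (simp add: set_lebesgue_integral_def)
  finally show ?thesis .
qed

lemma pinv1_DERIV:
  assumes "f \<in> schwartz"
  shows "(pinv 1 f has_real_derivative f x) (at x)"
proof -
  have "((\<lambda>z. pinv 1 f (x - 1) + integral {x - 1..z} f) has_real_derivative f x) (at x within {x - 1..x + 1})"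
    by (auto intro!: derivative_eq_intros integral_has_real_derivative schwartz_continuous_on assms)
  then have d: "((\<lambda>z. pinv 1 f (x - 1) + integral {x - 1..z} f) has_real_derivative f x) (at x)"
    by (simp add: at_within_Icc_at)
  show ?thesis
  proof (rule has_field_derivative_transform_within_open[OF d, of "{x - 1<..<x + 1}"])
    show "pinv 1 f (x - 1) + integral {x - 1..z} f = pinv 1 f z" if "z \<in> {x - 1<..<x + 1}" for z
      using pinv1_increment[OF assms, of "x - 1" z] that by simp
  qed auto
qed

text \<open>The odd kernel splits the total integral evenly between the two ends, with opposite
  signs. These limits fix the integration constants and supply all the boundary terms that occur
  later.\<close>

lemma pinv1_tendsto:
  assumes "f \<in> schwartz"
  shows "(pinv 1 f \<longlongrightarrow> (LBINT y. f y) / 2) at_top" "(pinv 1 f \<longlongrightarrow> - (LBINT y. f y) / 2) at_bot"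
proof -
  note [measurable] = schwartz_measurable[OF assms]
  have "((\<lambda>x. LBINT y. sgn (x - y) / 2 * f y) \<longlongrightarrow> (LBINT y. f y / 2)) at_top"
  proof (rule integral_dominated_convergence_at_top[where w = "\<lambda>y. \<bar>f y\<bar>"])
    show "integrable lborel (\<lambda>y. \<bar>f y\<bar>)" by (intro integrable_abs schwartz_integrable assms)
    show "\<forall>\<^sub>F x in at_top. AE y in lborel. norm (sgn (x - y) / 2 * f y) \<le> \<bar>f y\<bar>"
      by (intro always_eventually allI AE_I2) (auto simp: abs_mult abs_sgn_eq)
    show "AE y in lborel. ((\<lambda>x. sgn (x - y) / 2 * f y) \<longlongrightarrow> f y / 2) at_top"
    proof (rule AE_I2, rule tendsto_eventually)
      fix y show "\<forall>\<^sub>F x in at_top. sgn (x - y) / 2 * f y = f y / 2"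
        using eventually_gt_at_top[of y] by eventually_elim (simp add: sgn_if)
    qed
  qed auto
  then show "(pinv 1 f \<longlongrightarrow> (LBINT y. f y) / 2) at_top"
    unfolding pinv1_eq[symmetric] by (simp del: One_nat_def)
  have "((\<lambda>x. LBINT y. sgn (- x - y) / 2 * f y) \<longlongrightarrow> (LBINT y. - f y / 2)) at_top"
  proof (rule integral_dominated_convergence_at_top[where w = "\<lambda>y. \<bar>f y\<bar>"])
    show "integrable lborel (\<lambda>y. \<bar>f y\<bar>)" by (intro integrable_abs schwartz_integrable assms)
    show "\<forall>\<^sub>F x in at_top. AE y in lborel. norm (sgn (- x - y) / 2 * f y) \<le> \<bar>f y\<bar>"
      by (intro always_eventually allI AE_I2) (auto simp: abs_mult abs_sgn_eq)
    show "AE y in lborel. ((\<lambda>x. sgn (- x - y) / 2 * f y) \<longlongrightarrow> - f y / 2) at_top"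
    proof (rule AE_I2, rule tendsto_eventually)
      fix y show "\<forall>\<^sub>F x in at_top. sgn (- x - y) / 2 * f y = - f y / 2"
        using eventually_gt_at_top[of "- y"] by eventually_elim (simp add: sgn_if)
    qed
  qed auto
  then show "(pinv 1 f \<longlongrightarrow> - (LBINT y. f y) / 2) at_bot"
    unfolding pinv1_eq[symmetric] by (subst filterlim_at_bot_mirror) (simp del: One_nat_def)
qed

lemma pinv1_tempered:
  assumes "f \<in> schwartz"
  shows "pinv 1 f \<in> tempered"
proof (rule tempered_antideriv[OF pinv1_DERIV[OF assms] _ schwartz_imp_tempered[OF assms]])
  have "\<bar>pinv 1 f x\<bar> \<le> (LBINT y. \<bar>f y\<bar>) * (1 + x\<^sup>2) ^ 0" for x
  proof -
    have "\<bar>pinv 1 f x\<bar> \<le> (LBINT y. \<bar>sgn (x - y) / 2 * f y\<bar>)"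
      unfolding pinv1_eq by (rule integral_abs_bound)
    also have "\<dots> \<le> (LBINT y. \<bar>f y\<bar>)"
      by (rule integral_mono[OF integrable_abs[OF kernel1_integrable[OF assms]] integrable_abs[OF schwartz_integrable[OF assms]]])
         (auto simp: abs_mult abs_sgn_eq)
    finally show ?thesis by simp
  qed
  then show "polybounded (pinv 1 f)" unfolding polybounded_def by blast
qed

text \<open>When \<open>pinv2_eq\<close> is differentiated, the two terms x f x cancel.\<close>

lemma pinv2_DERIV:
  assumes "f \<in> schwartz"
  shows "(pinv 2 f has_real_derivative pinv 1 f x) (at x)"
proof -
  have yf: "(\<lambda>y. y * f y) \<in> schwartz"
    using schwartz_mult[OF assms tempered_id] by (simp add: mult.commute)
  have "((\<lambda>x. x * pinv 1 f x - pinv 1 (\<lambda>y. y * f y) x) has_real_derivative pinv 1 f x) (at x)"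
    by (rule derivative_eq_intros pinv1_DERIV assms yf refl | simp)+
  moreover have "pinv 2 f = (\<lambda>x. x * pinv 1 f x - pinv 1 (\<lambda>y. y * f y) x)"
    using pinv2_eq[OF assms] by blast
  ultimately show ?thesis by simp
qed

lemma pinv2_tempered:
  assumes "f \<in> schwartz"
  shows "pinv 2 f \<in> tempered"
proof -
  have yf: "(\<lambda>y. y * f y) \<in> schwartz"
    using schwartz_mult[OF assms tempered_id] by (simp add: mult.commute)
  have "pinv 2 f = (\<lambda>x. x * pinv 1 f x - pinv 1 (\<lambda>y. y * f y) x)"
    using pinv2_eq[OF assms] by blast
  then show ?thesis using assms yf by (simp add: tempered_intros pinv1_tempered del: One_nat_def)
qed

lemma pinv3_DERIV:
  assumes "f \<in> schwartz"
  shows "(pinv 3 f has_real_derivative pinv 2 f x) (at x)"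
proof -
  have yf: "(\<lambda>y. y * f y) \<in> schwartz"
    using schwartz_mult[OF assms tempered_id] by (simp add: mult.commute)
  have yyf: "(\<lambda>y. y\<^sup>2 * f y) \<in> schwartz"
    using schwartz_mult[OF assms tempered_power[OF tempered_id]] by (simp add: mult.commute)
  have "((\<lambda>x. (x\<^sup>2 * pinv 1 f x - 2 * x * pinv 1 (\<lambda>y. y * f y) x + pinv 1 (\<lambda>y. y\<^sup>2 * f y) x) / 2)
      has_real_derivative (2 * x * pinv 1 f x + x\<^sup>2 * f x - (2 * pinv 1 (\<lambda>y. y * f y) x + 2 * x * (x * f x)) + x\<^sup>2 * f x) / 2) (at x)"
    by (rule derivative_eq_intros pinv1_DERIV assms yf yyf refl | simp)+
  also have "(2 * x * pinv 1 f x + x\<^sup>2 * f x - (2 * pinv 1 (\<lambda>y. y * f y) x + 2 * x * (x * f x)) + x\<^sup>2 * f x) / 2 = pinv 2 f x"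
    unfolding pinv2_eq[OF assms] by (simp add: power2_eq_square field_simps del: One_nat_def)
  moreover have "pinv 3 f = (\<lambda>x. (x\<^sup>2 * pinv 1 f x - 2 * x * pinv 1 (\<lambda>y. y * f y) x + pinv 1 (\<lambda>y. y\<^sup>2 * f y) x) / 2)"
    using pinv3_eq[OF assms] by blast
  ultimately show ?thesis by simp
qed

lemma pinv3_tempered:
  assumes "f \<in> schwartz"
  shows "pinv 3 f \<in> tempered"
proof -
  have yf: "(\<lambda>y. y * f y) \<in> schwartz"
    using schwartz_mult[OF assms tempered_id] by (simp add: mult.commute)
  have yyf: "(\<lambda>y. y\<^sup>2 * f y) \<in> schwartz"
    using schwartz_mult[OF assms tempered_power[OF tempered_id]] by (simp add: mult.commute)
  have "(\<lambda>x. (x\<^sup>2 * pinv 1 f x - 2 * x * pinv 1 (\<lambda>y. y * f y) x + pinv 1 (\<lambda>y. y\<^sup>2 * f y) x) * (1 / 2)) \<in> tempered"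
    by (intro tempered_intros pinv1_tempered assms yf yyf)
  moreover have "pinv 3 f = (\<lambda>x. (x\<^sup>2 * pinv 1 f x - 2 * x * pinv 1 (\<lambda>y. y * f y) x + pinv 1 (\<lambda>y. y\<^sup>2 * f y) x) * (1 / 2))"
    by (rule ext) (simp add: pinv3_eq[OF assms] del: One_nat_def)
  ultimately show ?thesis by simp
qed

text \<open>Both sides have derivative g and hence differ by a constant. At infinity both tend to 0:
  f because it is Schwartz, \<open>pinv 1 g\<close> because g is a total derivative and has integral
  0.\<close>

lemma pinv1_inverse:
  assumes "f \<in> schwartz" "\<And>x. (f has_real_derivative g x) (at x)"
  shows "pinv 1 g = f"
proof
  fix x
  have g: "g = deriv f" using assms(2) by (metis DERIV_imp_deriv ext)
  then have gs: "g \<in> schwartz" using assms(1) schwartz_D by simp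
  have "((\<lambda>x. pinv 1 g x - f x) has_real_derivative 0) (at x)" for x
    using DERIV_diff[OF pinv1_DERIV[OF gs] assms(2)] by simp
  then obtain c where c: "\<And>x. pinv 1 g x - f x = c"
    by (metis DERIV_isconst_all)
  have "(LBINT x. g x) = 0" by (rule integral_schwartz_deriv[OF assms(2,1)])
  then have "((\<lambda>x. pinv 1 g x - f x) \<longlongrightarrow> 0 / 2 - 0) at_top"
    using pinv1_tendsto(1)[OF gs] schwartz_tendsto_0(1)[OF assms(1)] by (intro tendsto_diff) auto
  then have "c = 0" using c by (simp add: tendsto_const_iff)
  with c show "pinv 1 g x = f x" by (metis eq_iff_diff_eq_0)
qed

text \<open>By \<open>pinv2_eq\<close> it suffices to find decaying antiderivatives of f'' and of y
  f''. They are f' and y f' - f, and x f' - (x f' - f) = f.\<close>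

lemma pinv2_inverse:
  assumes "f \<in> schwartz"
  shows "pinv 2 (deriv (deriv f)) = f"
proof
  fix x
  have d: "deriv f \<in> schwartz" "deriv (deriv f) \<in> schwartz" using assms schwartz_D by auto
  have "pinv 1 (\<lambda>y. y * deriv (deriv f) y) = (\<lambda>y. deriv f y * y - f y)"
  proof (rule pinv1_inverse)
    show "(\<lambda>y. deriv f y * y - f y) \<in> schwartz" by (intro schwartz_intros tempered_id assms)
    show "((\<lambda>y. deriv f y * y - f y) has_real_derivative y * deriv (deriv f) y) (at y)" for y
      by (rule derivative_eq_intros schwartz_DERIV d assms refl | simp)+
  qed
  moreover have "pinv 1 (deriv (deriv f)) = deriv f" by (rule pinv1_inverse[OF d(1) schwartz_DERIV[OF d(1)]])
  ultimately show "pinv 2 (deriv (deriv f)) x = f x" by (simp add: pinv2_eq[OF d(2)] del: One_nat_def)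
qed

lemma pinv3_inverse:
  assumes "f \<in> schwartz"
  shows "pinv 3 ((deriv ^^ 3) f) = f"
proof
  fix x
  have d: "deriv f \<in> schwartz" "deriv (deriv f) \<in> schwartz" "deriv (deriv (deriv f)) \<in> schwartz"
    using assms schwartz_D by auto
  have "pinv 1 (\<lambda>y. y * deriv (deriv (deriv f)) y) = (\<lambda>y. deriv (deriv f) y * y - deriv f y)"
  proof (rule pinv1_inverse)
    show "(\<lambda>y. deriv (deriv f) y * y - deriv f y) \<in> schwartz" by (intro schwartz_intros tempered_id assms)
    show "((\<lambda>y. deriv (deriv f) y * y - deriv f y) has_real_derivative y * deriv (deriv (deriv f)) y) (at y)" for y
      by (rule derivative_eq_intros schwartz_DERIV d assms refl | simp)+
  qed
  moreover have "pinv 1 (\<lambda>y. y\<^sup>2 * deriv (deriv (deriv f)) y)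
      = (\<lambda>y. deriv (deriv f) y * y\<^sup>2 - deriv f y * (2 * y) + f y * 2)"
  proof (rule pinv1_inverse)
    show "(\<lambda>y. deriv (deriv f) y * y\<^sup>2 - deriv f y * (2 * y) + f y * 2) \<in> schwartz"
      by (intro schwartz_add schwartz_diff schwartz_mult schwartz_deriv tempered_intros assms)
    show "((\<lambda>y. deriv (deriv f) y * y\<^sup>2 - deriv f y * (2 * y) + f y * 2) has_real_derivative
        y\<^sup>2 * deriv (deriv (deriv f)) y) (at y)" for y
      by (rule derivative_eq_intros schwartz_DERIV d assms refl | simp)+
  qed
  moreover have "pinv 1 (deriv (deriv (deriv f))) = deriv (deriv f)"
    by (rule pinv1_inverse[OF d(2) schwartz_DERIV[OF d(2)]])
  ultimately have "pinv 3 (deriv (deriv (deriv f))) x = f x"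
    by (simp add: pinv3_eq[OF d(3)] power2_eq_square algebra_simps del: One_nat_def)
  then show "pinv 3 ((deriv ^^ 3) f) x = f x" by (simp add: numeral_3_eq_3)
qed

text \<open>\<open>pinv 2 f\<close> grows linearly, so the boundary terms of the integration by parts do not vanish,
  but those at the two ends cancel.\<close>

lemma pinv2_symmetric:
  assumes f: "f \<in> schwartz" and g: "g \<in> schwartz"
  shows "(LBINT x. g x * pinv 2 f x) = (LBINT x. f x * pinv 2 g x)"
proof -
  have yf: "(\<lambda>y. y * f y) \<in> schwartz" and yg: "(\<lambda>y. y * g y) \<in> schwartz"
    using schwartz_mult[OF f tempered_id] schwartz_mult[OF g tempered_id] by (simp_all add: mult.commute)
  define G where "G x = pinv 2 f x * pinv 1 g x - pinv 1 f x * pinv 2 g x" for x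
  \<comment> \<open>The growing parts x \<open>pinv 1 f\<close> \<open>pinv 1 g\<close> of the two
    products have cancelled. What is left consists of products of two \<open>pinv 1\<close> terms;
    from one end to the other both factors change sign, so the limits agree.\<close>
  have G: "G = (\<lambda>x. pinv 1 f x * pinv 1 (\<lambda>y. y * g y) x - pinv 1 (\<lambda>y. y * f y) x * pinv 1 g x)"
    unfolding G_def pinv2_eq[OF f] pinv2_eq[OF g] by (simp add: algebra_simps)
  let ?I = "\<lambda>h. LBINT x. h x"
  let ?L = "?I f / 2 * (?I (\<lambda>y. y * g y) / 2) - ?I (\<lambda>y. y * f y) / 2 * (?I g / 2)"
  have top: "(G \<longlongrightarrow> ?L) at_top"
    unfolding G by (intro tendsto_diff tendsto_mult pinv1_tendsto f g yf yg)
  have "(G \<longlongrightarrow> - ?I f / 2 * (- ?I (\<lambda>y. y * g y) / 2) - - ?I (\<lambda>y. y * f y) / 2 * (- ?I g / 2)) at_bot"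
    unfolding G by (intro tendsto_diff tendsto_mult pinv1_tendsto f g yf yg)
  then have bot: "(G \<longlongrightarrow> ?L) at_bot" by simp
  have fg: "(\<lambda>x. g x * pinv 2 f x) \<in> schwartz" and gf: "(\<lambda>x. f x * pinv 2 g x) \<in> schwartz"
    by (intro schwartz_mult pinv2_tempered f g)+
  have "(LBINT x. g x * pinv 2 f x - f x * pinv 2 g x) = ?L - ?L"
  proof (rule integral_total_derivative[OF _ _ _ bot top])
    show "(G has_real_derivative g x * pinv 2 f x - f x * pinv 2 g x) (at x)" for x
      unfolding G_def[abs_def] by (rule derivative_eq_intros pinv2_DERIV pinv1_DERIV f g refl | simp add: algebra_simps)+
    show "isCont (\<lambda>x. g x * pinv 2 f x - f x * pinv 2 g x) x" for x
      using schwartz_diff[OF fg gf] by (rule schwartz_continuous)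
    show "integrable lborel (\<lambda>x. g x * pinv 2 f x - f x * pinv 2 g x)"
      using schwartz_diff[OF fg gf] by (rule schwartz_integrable)
  qed
  then show ?thesis using schwartz_integrable[OF fg] schwartz_integrable[OF gf] by simp
qed

section \<open>The Hamiltonian operators\<close>

lemma comp_vec3 [simp]: "comp (vec3 a b c) 1 = a" "comp (vec3 a b c) 2 = b" "comp (vec3 a b c) 3 = c"
  by (auto simp: comp_def vec3_def)

lemma vec3_nth [simp]: "vec3 a b c x $ 1 = a x" "vec3 a b c x $ 2 = b x" "vec3 a b c x $ 3 = c x"
  by (auto simp: vec3_def)

lemma vec3_eq_iff: "vec3 a b c = vec3 a' b' c' \<longleftrightarrow> a = a' \<and> b = b' \<and> c = c'"
  by (metis comp_vec3)

lemma pairing_vec3: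
  "pairing (vec3 a b c) (vec3 a' b' c') = (LBINT x. a' x * a x + b' x * b x + c' x * c x)"
  unfolding pairing_def by (simp add: inner_vec_def sum_3 mult.commute)

section \<open>\<open>K1\<close> on its domain as a local expression\<close>

lemma deriv_mult_at:
  "f \<in> tempered \<Longrightarrow> g \<in> tempered \<Longrightarrow> deriv (\<lambda>x. f x * g x) x = deriv f x * g x + f x * deriv g x"
  by (simp add: deriv_mult_fun tempered_D)

text \<open>\<open>Omega_adj\<close> with the products differentiated out; the coefficient 3/2 is
  1/2 + 1. Being linear in u, v, w, it can also be evaluated at a variation of the state.\<close>

definition density_Omega_adj where
  "density_Omega_adj u v w a b c x =
     - u x * deriv a x - 3/2 * v x * deriv b x - 1/2 * deriv v x * b x
     - 3/2 * w x * deriv c x - 1/2 * deriv w x * c x"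

lemma Omega_adj_vec3:
  assumes "v \<in> schwartz" "w \<in> schwartz" "b \<in> tempered" "c \<in> tempered"
  shows "Omega_adj (vec3 u v w) (vec3 a b c) = density_Omega_adj u v w a b c"
  using assms unfolding Omega_adj_def density_Omega_adj_def Let_def
  by (intro ext) (simp add: deriv_mult_at schwartz_imp_tempered algebra_simps)

lemma density_Omega_adj_schwartz:
  assumes "u \<in> schwartz" "v \<in> schwartz" "w \<in> schwartz" "a \<in> tempered" "b \<in> tempered" "c \<in> tempered"
  shows "density_Omega_adj u v w a b c \<in> schwartz"
  unfolding density_Omega_adj_def[abs_def]
  by (intro schwartz_intros tempered_deriv assms)

text \<open>The value of \<open>K1\<close> with N and g in place of the results of
  \<open>pinv 1\<close> and \<open>pinv 3\<close>; the first component a enters only through g. The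
  two inverse derivatives in \<open>K1\<close> combine into one, applied to v b - w c, and -2 (v
  g'/2 + (v g)') = -3 v g' - 2 v' g gives the last coefficients.\<close>

definition K1_value where
  "K1_value u v w b c N g = vec3
     (\<lambda>x. - 2 * (deriv u x * g x + u x * deriv g x))
     (\<lambda>x. 3/2 * v x * N x - (u x)\<^sup>2 * c x - 3 * v x * deriv g x - 2 * deriv v x * g x)
     (\<lambda>x. (u x)\<^sup>2 * b x - 3/2 * w x * N x - 3 * w x * deriv g x - 2 * deriv w x * g x)"

lemma K1_vec3:
  assumes uvw: "u \<in> schwartz" "v \<in> schwartz" "w \<in> schwartz"
    and abc: "a \<in> tempered" "b \<in> tempered" "c \<in> tempered"
  shows "K1 (vec3 u v w) (vec3 a b c) = K1_value u v w b c
     (pinv 1 (\<lambda>x. v x * b x - w x * c x)) (pinv 3 (density_Omega_adj u v w a b c))"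
proof -
  have g: "pinv 3 (density_Omega_adj u v w a b c) \<in> tempered"
    by (intro pinv3_tempered density_Omega_adj_schwartz assms)
  have N: "pinv 1 (\<lambda>x. v x * b x - w x * c x) x = pinv 1 (\<lambda>x. v x * b x) x - pinv 1 (\<lambda>x. w x * c x) x" for x
    by (intro pinv_diff schwartz_mult assms)
  show ?thesis
    unfolding K1_def Let_def K1_value_def Omega_def
    by (intro ext)
       (simp add: vec_eq_iff forall_3 Omega_adj_vec3 assms deriv_mult_at schwartz_imp_tempered g N
          del: One_nat_def; simp add: field_simps del: One_nat_def)
qed

text \<open>The equations for F and f are stated with \<open>has_real_derivative\<close> so that
  they can act as differentiation rules. Tried before the generic ones, they turn the derivatives of
  F and of f'' directly into expressions in the state and the covector.\<close>

definition K1_covector where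
  "K1_covector u v w a b c F f \<longleftrightarrow>
     a \<in> schwartz \<and> b \<in> tempered \<and> c \<in> tempered \<and> F \<in> schwartz \<and> f \<in> schwartz \<and>
     (\<forall>x. (F has_real_derivative v x * b x - w x * c x) (at x)) \<and>
     (\<forall>x. (deriv (deriv f) has_real_derivative density_Omega_adj u v w a b c x) (at x))"

lemma deriv_deriv_pinv2: "f \<in> schwartz \<Longrightarrow> deriv (deriv (pinv 2 f)) = f"
  using pinv1_DERIV pinv2_DERIV by (metis DERIV_imp_deriv ext)

lemma covectorsE:
  assumes "\<xi> \<in> covectors"
  obtains a b c where "\<xi> = vec3 a b c" "a \<in> schwartz" "b \<in> tempered" "c \<in> tempered"
    "deriv (deriv b) \<in> schwartz" "deriv (deriv c) \<in> schwartz"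
    "pinv 2 (deriv (deriv b)) = b" "pinv 2 (deriv (deriv c)) = c"
proof -
  obtain a B C where "\<xi> = vec3 a (pinv 2 B) (pinv 2 C)" "a \<in> schwartz" "B \<in> schwartz" "C \<in> schwartz"
    using assms unfolding covectors_def by blast
  then show thesis
    using that[of a "pinv 2 B" "pinv 2 C"] by (simp add: deriv_deriv_pinv2 pinv2_tempered)
qed

lemma K1_domainE:
  assumes "\<xi> \<in> K1_domain (vec3 u v w)" "v \<in> schwartz" "w \<in> schwartz"
  obtains a b c F f where "\<xi> = vec3 a b c" "K1_covector u v w a b c F f"
    "deriv (deriv b) \<in> schwartz" "deriv (deriv c) \<in> schwartz"
proof -
  obtain a b c where \<xi>: "\<xi> = vec3 a b c" "a \<in> schwartz" "b \<in> tempered" "c \<in> tempered"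
      "deriv (deriv b) \<in> schwartz" "deriv (deriv c) \<in> schwartz"
    using assms(1) covectorsE unfolding K1_domain_def by blast
  obtain F f where F: "F \<in> schwartz" "(\<lambda>x. v x * b x - w x * c x) = deriv F"
    and f: "f \<in> schwartz" "density_Omega_adj u v w a b c = (deriv ^^ 3) f"
    using assms \<xi> unfolding K1_domain_def by (auto simp: Omega_adj_vec3)
  have "(F has_real_derivative v x * b x - w x * c x) (at x)" for x
    using schwartz_DERIV[OF F(1), of x] fun_cong[OF F(2), of x] by simp
  moreover have "(deriv (deriv f) has_real_derivative density_Omega_adj u v w a b c x) (at x)" for x
    using schwartz_DERIV[OF schwartz_deriv[OF schwartz_deriv[OF f(1)]]]
    by (simp add: f(2) numeral_3_eq_3)
  ultimately show thesis using that \<xi> F(1) f(1) unfolding K1_covector_def by blast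
qed

lemma K1_covector_pinv:
  assumes "K1_covector u v w a b c F f"
  shows "pinv 1 (\<lambda>x. v x * b x - w x * c x) = F" "pinv 3 (density_Omega_adj u v w a b c) = f"
proof -
  show "pinv 1 (\<lambda>x. v x * b x - w x * c x) = F"
    using assms unfolding K1_covector_def by (intro pinv1_inverse) auto
  have "(deriv ^^ 3) f = density_Omega_adj u v w a b c"
    using assms unfolding K1_covector_def by (auto simp: numeral_3_eq_3 intro!: DERIV_imp_deriv)
  with pinv3_inverse[of f] show "pinv 3 (density_Omega_adj u v w a b c) = f"
    using assms unfolding K1_covector_def by simp
qed

lemma K1_covector_K1:
  assumes "K1_covector u v w a b c F f" "u \<in> schwartz" "v \<in> schwartz" "w \<in> schwartz"
  shows "K1 (vec3 u v w) (vec3 a b c) = K1_value u v w b c F f"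
  using K1_vec3[OF assms(2-4), of a b c] K1_covector_pinv[OF assms(1)] assms(1)
  unfolding K1_covector_def by (simp add: schwartz_imp_tempered)

lemma K1_covectorD:
  assumes "K1_covector u v w a b c F f"
  shows "a \<in> schwartz" "b \<in> tempered" "c \<in> tempered" "F \<in> schwartz" "f \<in> schwartz"
    "(F has_real_derivative v x * b x - w x * c x) (at x)"
    "(deriv (deriv f) has_real_derivative density_Omega_adj u v w a b c x) (at x)"
  using assms unfolding K1_covector_def by auto

lemma K1_covector_tempered:
  assumes "K1_covector u v w a b c F f"
  shows "a \<in> tempered" "b \<in> tempered" "c \<in> tempered" "F \<in> tempered" "f \<in> tempered"
  using assms schwartz_imp_tempered unfolding K1_covector_def by auto

section \<open>Skew-symmetry of \<open>K1\<close>\<close>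

lemma K1_covector_skew:
  assumes uvw: "u \<in> schwartz" "v \<in> schwartz" "w \<in> schwartz"
    and 1: "K1_covector u v w a1 b1 c1 F1 f1" and 2: "K1_covector u v w a2 b2 c2 F2 f2"
  shows "pairing (vec3 a1 b1 c1) (K1_value u v w b2 c2 F2 f2)
       = - pairing (vec3 a2 b2 c2) (K1_value u v w b1 c1 F1 f1)"
proof -
  note s = uvw K1_covectorD(1-5)[OF 1] K1_covectorD(1-5)[OF 2]
  note t = uvw[THEN schwartz_imp_tempered] K1_covector_tempered[OF 1] K1_covector_tempered[OF 2]
  define P where "P b c N g a' b' c' x = (- 2 * (deriv u x * g x + u x * deriv g x)) * a' x
     + (3/2 * v x * N x - (u x)\<^sup>2 * c x - 3 * v x * deriv g x - 2 * deriv v x * g x) * b' x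
     + ((u x)\<^sup>2 * b x - 3/2 * w x * N x - 3 * w x * deriv g x - 2 * deriv w x * g x) * c' x"
    for b c N g a' b' c' :: "real \<Rightarrow> real" and x
  have P: "P b c N g a' b' c' \<in> schwartz"
    if "b \<in> tempered" "c \<in> tempered" "N \<in> tempered" "g \<in> tempered"
      "a' \<in> tempered" "b' \<in> tempered" "c' \<in> tempered" for b c N g a' b' c'
    unfolding P_def[abs_def]
    by (intro schwartz_intros tempered_deriv uvw that zero_less_numeral)
  \<comment> \<open>The term in F1 F2 comes from F1 F2' + F1' F2. The terms in derivatives of f1 and
    f2 come from f1''' f2 + f1 f2''' = (f1'' f2 - f1' f2' + f1 f2'')'. The others move
    \<open>Omega\<close> onto the opposite covector, where it becomes \<open>Omega_adj\<close>, that
    is, a third derivative of f1 or f2.\<close>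
  define G where "G x = 3/2 * F1 x * F2 x
      - 2 * u x * a1 x * f2 x - 3 * v x * b1 x * f2 x - 3 * w x * c1 x * f2 x
      - 2 * u x * a2 x * f1 x - 3 * v x * b2 x * f1 x - 3 * w x * c2 x * f1 x
      - 2 * deriv (deriv f1) x * f2 x + 2 * deriv f1 x * deriv f2 x - 2 * deriv (deriv f2) x * f1 x" for x
  have "(LBINT x. P b2 c2 F2 f2 a1 b1 c1 x) = (LBINT x. - P b1 c1 F1 f1 a2 b2 c2 x)"
  proof (rule integral_eq_mod_deriv[where G = G])
    show "G \<in> schwartz"
      unfolding G_def[abs_def]
      by (intro schwartz_intros tempered_deriv s t)
    show "(G has_real_derivative P b2 c2 F2 f2 a1 b1 c1 x - - P b1 c1 F1 f1 a2 b2 c2 x) (at x)" for x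
      unfolding G_def[abs_def]
      by (rule DERIV_cong, (rule K1_covectorD(6,7)[OF 1] K1_covectorD(6,7)[OF 2] derivative_intros
            tempered_DERIV tempered_deriv t)+, unfold P_def density_Omega_adj_def) algebra
  qed (intro P schwartz_uminus t)+
  then show ?thesis
    unfolding K1_value_def pairing_vec3 P_def Bochner_Integration.integral_minus .
qed

section \<open>The derivative of \<open>K1\<close> in the direction of a variation\<close>

definition K1_variation where
  "K1_variation u v w hu hv hw b c N M g k = vec3
     (\<lambda>x. - 2 * (deriv hu x * g x + hu x * deriv g x + deriv u x * k x + u x * deriv k x))
     (\<lambda>x. 3/2 * (hv x * N x + v x * M x) - 2 * u x * hu x * c x
        - 3 * (hv x * deriv g x + v x * deriv k x) - 2 * (deriv hv x * g x + deriv v x * k x))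
     (\<lambda>x. 2 * u x * hu x * b x - 3/2 * (hw x * N x + w x * M x)
        - 3 * (hw x * deriv g x + w x * deriv k x) - 2 * (deriv hw x * g x + deriv w x * k x))"

lemma schwartz_lincomb: "f \<in> schwartz \<Longrightarrow> g \<in> schwartz \<Longrightarrow> (\<lambda>x. f x + e * g x) \<in> schwartz"
  by (intro schwartz_add schwartz_cmult)

text \<open>\<open>K1_value\<close> is homogeneous of degree two in the state, N and g jointly, and
  N and g depend linearly on the state. Along a line \<open>K1\<close> is therefore a quadratic
  polynomial in e, and its directional derivative is the linear coefficient.\<close>

lemma K1_vec3_shift:
  assumes U: "u \<in> schwartz" "v \<in> schwartz" "w \<in> schwartz"
    and h: "hu \<in> schwartz" "hv \<in> schwartz" "hw \<in> schwartz"
    and z: "a \<in> tempered" "b \<in> tempered" "c \<in> tempered"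
  defines "N \<equiv> pinv 1 (\<lambda>x. v x * b x - w x * c x)" and "M \<equiv> pinv 1 (\<lambda>x. hv x * b x - hw x * c x)"
    and "g \<equiv> pinv 3 (density_Omega_adj u v w a b c)"
    and "k \<equiv> pinv 3 (density_Omega_adj hu hv hw a b c)"
  shows "K1 (\<lambda>x. vec3 u v w x + e *\<^sub>R vec3 hu hv hw x) (vec3 a b c) x
     = K1_value u v w b c N g x + e *\<^sub>R K1_variation u v w hu hv hw b c N M g k x
       + e\<^sup>2 *\<^sub>R K1_value hu hv hw b c M k x"
proof -
  have sh: "(\<lambda>x. vec3 u v w x + e *\<^sub>R vec3 hu hv hw x)
      = vec3 (\<lambda>x. u x + e * hu x) (\<lambda>x. v x + e * hv x) (\<lambda>x. w x + e * hw x)"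
    by (simp add: fun_eq_iff vec_eq_iff forall_3)
  have d: "deriv (\<lambda>x. p x + e * q x) x = deriv p x + e * deriv q x"
    if "p \<in> tempered" "q \<in> tempered" for p q x
    by (rule DERIV_imp_deriv) (rule derivative_intros tempered_DERIV that DERIV_cmult)+
  have "(\<lambda>x. (v x + e * hv x) * b x - (w x + e * hw x) * c x)
      = (\<lambda>x. (v x * b x - w x * c x) + e * (hv x * b x - hw x * c x))"
    by (simp add: fun_eq_iff algebra_simps)
  then have N: "pinv 1 (\<lambda>x. (v x + e * hv x) * b x - (w x + e * hw x) * c x) = (\<lambda>x. N x + e * M x)"
    unfolding N_def M_def
    by (simp add: fun_eq_iff pinv_add pinv_cmult schwartz_intros U h z del: One_nat_def)
  have O: "density_Omega_adj (\<lambda>x. u x + e * hu x) (\<lambda>x. v x + e * hv x) (\<lambda>x. w x + e * hw x) a b c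
      = (\<lambda>x. density_Omega_adj u v w a b c x + e * density_Omega_adj hu hv hw a b c x)"
    using U h by (simp add: fun_eq_iff density_Omega_adj_def d schwartz_imp_tempered algebra_simps add_divide_distrib)
  have g: "pinv 3 (density_Omega_adj (\<lambda>x. u x + e * hu x) (\<lambda>x. v x + e * hv x) (\<lambda>x. w x + e * hw x) a b c)
      = (\<lambda>x. g x + e * k x)"
    unfolding g_def k_def O
    by (simp add: fun_eq_iff pinv_add pinv_cmult density_Omega_adj_schwartz schwartz_cmult U h z)
  have gk: "g \<in> tempered" "k \<in> tempered"
    unfolding g_def k_def by (intro pinv3_tempered density_Omega_adj_schwartz U h z)+
  have "K1 (\<lambda>x. vec3 u v w x + e *\<^sub>R vec3 hu hv hw x) (vec3 a b c)
      = K1_value (\<lambda>x. u x + e * hu x) (\<lambda>x. v x + e * hv x) (\<lambda>x. w x + e * hw x) b c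
          (\<lambda>x. N x + e * M x) (\<lambda>x. g x + e * k x)"
    unfolding sh N[symmetric] g[symmetric] by (intro K1_vec3 schwartz_lincomb U h z)
  then show ?thesis
    unfolding K1_value_def K1_variation_def
    by (simp add: vec_eq_iff forall_3 d U h gk schwartz_imp_tempered)
       (simp add: field_simps power2_eq_square)
qed

text \<open>The integrand of the pairing of the first covector with the derivative of
  \<open>K1\<close> on the third one, after all derivatives and inverse derivatives have been moved
  off the direction h. It is antisymmetric in the indices 1 and 3, as the derivative of a skew
  operator should be.\<close>

definition variation_density where
  "variation_density u a1 b1 c1 F1 f1 a3 b3 c3 F3 f3 hu hv hw x =
     hu x * (2 * u x * (c1 x * b3 x - b1 x * c3 x) + 2 * (deriv a1 x * f3 x - deriv a3 x * f1 x))
   + hv x * (3/2 * (b1 x * F3 x - b3 x * F1 x) + 2 * (deriv b1 x * f3 x - deriv b3 x * f1 x)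
             - (b1 x * deriv f3 x - b3 x * deriv f1 x))
   + hw x * (- 3/2 * (c1 x * F3 x - c3 x * F1 x) + 2 * (deriv c1 x * f3 x - deriv c3 x * f1 x)
             - (c1 x * deriv f3 x - c3 x * deriv f1 x))"

lemma variation_density_schwartz:
  assumes "u \<in> schwartz" "K1_covector u v w a1 b1 c1 F1 f1" "K1_covector u v w a3 b3 c3 F3 f3"
    "hu \<in> schwartz" "hv \<in> schwartz" "hw \<in> schwartz"
  shows "variation_density u a1 b1 c1 F1 f1 a3 b3 c3 F3 f3 hu hv hw \<in> schwartz"
  unfolding variation_density_def[abs_def]
  by (intro schwartz_add schwartz_mult tempered_intros assms assms(1)[THEN schwartz_imp_tempered]
        K1_covector_tempered[OF assms(2)] K1_covector_tempered[OF assms(3)])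

lemma pairing_K1_variation:
  assumes U: "u \<in> schwartz" "v \<in> schwartz" "w \<in> schwartz"
    and h: "hu \<in> schwartz" "hv \<in> schwartz" "hw \<in> schwartz"
    and 1: "K1_covector u v w a1 b1 c1 F1 f1" and 3: "K1_covector u v w a3 b3 c3 F3 f3"
  defines "M \<equiv> pinv 1 (\<lambda>x. hv x * b3 x - hw x * c3 x)"
    and "k \<equiv> pinv 3 (density_Omega_adj hu hv hw a3 b3 c3)"
  shows "pairing (vec3 a1 b1 c1) (K1_variation u v w hu hv hw b3 c3 F3 M f3 k)
     = (LBINT x. variation_density u a1 b1 c1 F1 f1 a3 b3 c3 F3 f3 hu hv hw x)"
proof -
  note s = U h K1_covectorD(1-5)[OF 1] K1_covectorD(1-5)[OF 3]
  note t = U[THEN schwartz_imp_tempered] h[THEN schwartz_imp_tempered]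
    K1_covector_tempered[OF 1] K1_covector_tempered[OF 3]
  let ?O = "density_Omega_adj hu hv hw a3 b3 c3"
  have O: "?O \<in> schwartz" by (intro density_Omega_adj_schwartz s schwartz_imp_tempered)
  have vb: "(\<lambda>x. hv x * b3 x - hw x * c3 x) \<in> schwartz" by (intro schwartz_intros s)
  have M: "M \<in> tempered" "(M has_real_derivative hv x * b3 x - hw x * c3 x) (at x)" for x
    unfolding M_def by (intro pinv1_tempered pinv1_DERIV vb)+
  have k: "k \<in> tempered" unfolding k_def by (intro pinv3_tempered O)
  have "deriv k = pinv 2 ?O" "deriv (pinv 2 ?O) = pinv 1 ?O"
    unfolding k_def by (intro ext DERIV_imp_deriv pinv3_DERIV pinv2_DERIV O)+
  then have k': "(deriv (deriv k) has_real_derivative ?O x) (at x)" for x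
    using pinv1_DERIV[OF O] by simp
  show ?thesis
    unfolding K1_variation_def pairing_vec3
  proof (rule integral_eq_mod_deriv)
    \<comment> \<open>F1 M moves \<open>pinv 1\<close> onto F1; the terms pairing derivatives of f1
      with derivatives of k move \<open>pinv 3\<close> onto f1. The terms in u, v, w turn
      \<open>Omega\<close> into \<open>Omega_adj\<close>, and those in hu, hv, hw remove the
      remaining derivatives of the direction. M and k need not decay, but every term has a Schwartz
      factor.\<close>
    let ?G = "\<lambda>x. 3/2 * F1 x * M x - 2 * u x * a1 x * k x - 3 * v x * b1 x * k x - 3 * w x * c1 x * k x
      - 2 * deriv (deriv f1) x * k x + 2 * deriv f1 x * deriv k x - 2 * f1 x * deriv (deriv k) x
      - f1 x * hv x * b3 x - f1 x * hw x * c3 x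
      - 2 * a1 x * hu x * f3 x - 2 * hv x * b1 x * f3 x - 2 * hw x * c1 x * f3 x"
    show "?G \<in> schwartz"
      by (intro schwartz_intros tempered_deriv M(1) k s t)
    show "(?G has_real_derivative
        - 2 * (deriv hu x * f3 x + hu x * deriv f3 x + deriv u x * k x + u x * deriv k x) * a1 x
        + (3/2 * (hv x * F3 x + v x * M x) - 2 * u x * hu x * c3 x
           - 3 * (hv x * deriv f3 x + v x * deriv k x) - 2 * (deriv hv x * f3 x + deriv v x * k x)) * b1 x
        + (2 * u x * hu x * b3 x - 3/2 * (hw x * F3 x + w x * M x)
           - 3 * (hw x * deriv f3 x + w x * deriv k x) - 2 * (deriv hw x * f3 x + deriv w x * k x)) * c1 x
        - variation_density u a1 b1 c1 F1 f1 a3 b3 c3 F3 f3 hu hv hw x) (at x)" for x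
      by (rule DERIV_cong, (rule K1_covectorD(6,7)[OF 1] K1_covectorD(6,7)[OF 3] M(2) k' derivative_intros
            tempered_DERIV tempered_deriv t k)+, unfold variation_density_def density_Omega_adj_def) algebra
    show "variation_density u a1 b1 c1 F1 f1 a3 b3 c3 F3 f3 hu hv hw \<in> schwartz"
      by (rule variation_density_schwartz[OF U(1) 1 3 h])
    show "(\<lambda>x. - 2 * (deriv hu x * f3 x + hu x * deriv f3 x + deriv u x * k x + u x * deriv k x) * a1 x
        + (3/2 * (hv x * F3 x + v x * M x) - 2 * u x * hu x * c3 x
           - 3 * (hv x * deriv f3 x + v x * deriv k x) - 2 * (deriv hv x * f3 x + deriv v x * k x)) * b1 x
        + (2 * u x * hu x * b3 x - 3/2 * (hw x * F3 x + w x * M x)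
           - 3 * (hw x * deriv f3 x + w x * deriv k x) - 2 * (deriv hw x * f3 x + deriv w x * k x)) * c1 x) \<in> schwartz"
      by (intro schwartz_intros tempered_deriv s M(1) k t)
  qed
qed

text \<open>The cyclic sums of the densities are alternating in the three covectors; the signed sums of the
  following potentials over all permutations are antiderivatives of them, the coefficients being
  determined by comparison with a general ansatz of the right weight.\<close>

definition K1_potential where
  "K1_potential u v w bi ci fi cj Fj fj fk x =
     - 4 * fi x * deriv fj x * deriv (deriv fk) x + 3 * Fj x * (v x * bi x - w x * ci x) * fk x
     - 2 * (u x)\<^sup>2 * bi x * cj x * fk x"

definition J1_potential where
  "J1_potential bi cj Fk fk x =
     - 2 * fk x * deriv bi x * deriv cj x + deriv fk x * (bi x * deriv cj x + deriv bi x * cj x)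
     - deriv (deriv fk) x * bi x * cj x + 3/2 * Fk x * (deriv bi x * cj x - bi x * deriv cj x)"

text \<open>Once the equations for F and f have eliminated the first derivative of F and the third
  derivative of f, the claim is a polynomial identity in the state, the covectors, F, f and their
  derivatives.\<close>

lemma K1_cyclic_density:
  assumes U: "u \<in> schwartz" "v \<in> schwartz" "w \<in> schwartz"
    and 1: "K1_covector u v w a1 b1 c1 F1 f1" and 2: "K1_covector u v w a2 b2 c2 F2 f2"
    and 3: "K1_covector u v w a3 b3 c3 F3 f3"
  defines "G \<equiv> \<lambda>x.
      K1_potential u v w b1 c1 f1 c2 F2 f2 f3 x + K1_potential u v w b2 c2 f2 c3 F3 f3 f1 x
    + K1_potential u v w b3 c3 f3 c1 F1 f1 f2 x - K1_potential u v w b2 c2 f2 c1 F1 f1 f3 x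
    - K1_potential u v w b3 c3 f3 c2 F2 f2 f1 x - K1_potential u v w b1 c1 f1 c3 F3 f3 f2 x"
  shows "G \<in> schwartz"
    "(G has_real_derivative
       variation_density u a1 b1 c1 F1 f1 a3 b3 c3 F3 f3
         (comp (K1_value u v w b2 c2 F2 f2) 1) (comp (K1_value u v w b2 c2 F2 f2) 2) (comp (K1_value u v w b2 c2 F2 f2) 3) x
     + variation_density u a2 b2 c2 F2 f2 a1 b1 c1 F1 f1
         (comp (K1_value u v w b3 c3 F3 f3) 1) (comp (K1_value u v w b3 c3 F3 f3) 2) (comp (K1_value u v w b3 c3 F3 f3) 3) x
     + variation_density u a3 b3 c3 F3 f3 a2 b2 c2 F2 f2
         (comp (K1_value u v w b1 c1 F1 f1) 1) (comp (K1_value u v w b1 c1 F1 f1) 2) (comp (K1_value u v w b1 c1 F1 f1) 3) x) (at x)"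
proof -
  note s = U K1_covectorD(1-5)[OF 1] K1_covectorD(1-5)[OF 2] K1_covectorD(1-5)[OF 3]
  note t = U[THEN schwartz_imp_tempered]
    K1_covector_tempered[OF 1] K1_covector_tempered[OF 2] K1_covector_tempered[OF 3]
  show "G \<in> schwartz"
    unfolding G_def K1_potential_def
    by (intro schwartz_intros tempered_diff tempered_mult tempered_deriv s t zero_less_numeral)
  show "(G has_real_derivative
       variation_density u a1 b1 c1 F1 f1 a3 b3 c3 F3 f3
         (comp (K1_value u v w b2 c2 F2 f2) 1) (comp (K1_value u v w b2 c2 F2 f2) 2) (comp (K1_value u v w b2 c2 F2 f2) 3) x
     + variation_density u a2 b2 c2 F2 f2 a1 b1 c1 F1 f1
         (comp (K1_value u v w b3 c3 F3 f3) 1) (comp (K1_value u v w b3 c3 F3 f3) 2) (comp (K1_value u v w b3 c3 F3 f3) 3) x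
     + variation_density u a3 b3 c3 F3 f3 a2 b2 c2 F2 f2
         (comp (K1_value u v w b1 c1 F1 f1) 1) (comp (K1_value u v w b1 c1 F1 f1) 2) (comp (K1_value u v w b1 c1 F1 f1) 3) x) (at x)"
    unfolding G_def K1_potential_def
    by (rule DERIV_cong, (rule K1_covectorD(6,7)[OF 1] K1_covectorD(6,7)[OF 2] K1_covectorD(6,7)[OF 3]
          derivative_intros tempered_DERIV tempered_deriv t)+,
        unfold variation_density_def density_Omega_adj_def K1_value_def comp_vec3)
      (simp add: algebra_simps power2_eq_square)
qed

text \<open>Terms with two factors a' cancel in the cyclic sum. Those of the form u a' b c come from
  the third derivative of f that arises from f'' b c in the potential, since
  \<open>Omega_adj\<close> contains - u a'.\<close>

lemma J1_cyclic_density: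
  assumes 1: "K1_covector u v w a1 b1 c1 F1 f1" and 2: "K1_covector u v w a2 b2 c2 F2 f2"
    and 3: "K1_covector u v w a3 b3 c3 F3 f3"
  defines "G \<equiv> \<lambda>x.
      J1_potential b1 c2 F3 f3 x + J1_potential b2 c3 F1 f1 x + J1_potential b3 c1 F2 f2 x
    - J1_potential b2 c1 F3 f3 x - J1_potential b3 c2 F1 f1 x - J1_potential b1 c3 F2 f2 x"
  shows "G \<in> schwartz"
    "(G has_real_derivative
       variation_density u a1 b1 c1 F1 f1 a3 b3 c3 F3 f3
         (\<lambda>x. 1/2 * deriv a2 x) (\<lambda>x. - deriv (deriv c2) x) (deriv (deriv b2)) x
     + variation_density u a2 b2 c2 F2 f2 a1 b1 c1 F1 f1
         (\<lambda>x. 1/2 * deriv a3 x) (\<lambda>x. - deriv (deriv c3) x) (deriv (deriv b3)) x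
     + variation_density u a3 b3 c3 F3 f3 a2 b2 c2 F2 f2
         (\<lambda>x. 1/2 * deriv a1 x) (\<lambda>x. - deriv (deriv c1) x) (deriv (deriv b1)) x) (at x)"
proof -
  note s = K1_covectorD(1-5)[OF 1] K1_covectorD(1-5)[OF 2] K1_covectorD(1-5)[OF 3]
  note t = K1_covector_tempered[OF 1] K1_covector_tempered[OF 2] K1_covector_tempered[OF 3]
  show "G \<in> schwartz"
    unfolding G_def J1_potential_def
    by (intro schwartz_intros tempered_add tempered_diff tempered_mult tempered_deriv s t)
  show "(G has_real_derivative
       variation_density u a1 b1 c1 F1 f1 a3 b3 c3 F3 f3
         (\<lambda>x. 1/2 * deriv a2 x) (\<lambda>x. - deriv (deriv c2) x) (deriv (deriv b2)) x
     + variation_density u a2 b2 c2 F2 f2 a1 b1 c1 F1 f1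
         (\<lambda>x. 1/2 * deriv a3 x) (\<lambda>x. - deriv (deriv c3) x) (deriv (deriv b3)) x
     + variation_density u a3 b3 c3 F3 f3 a2 b2 c2 F2 f2
         (\<lambda>x. 1/2 * deriv a1 x) (\<lambda>x. - deriv (deriv c1) x) (deriv (deriv b1)) x) (at x)"
    unfolding G_def J1_potential_def
    by (rule DERIV_cong, (rule K1_covectorD(6,7)[OF 1] K1_covectorD(6,7)[OF 2] K1_covectorD(6,7)[OF 3]
          derivative_intros tempered_DERIV tempered_deriv t)+,
        unfold variation_density_def density_Omega_adj_def) algebra
qed

section \<open>Skew-symmetry of \<open>J1\<close>, and the pencil spanned by the two
  operators\<close>

lemma pairing_lincomb:
  assumes "a \<in> tempered" "b \<in> tempered" "c \<in> tempered"
    and "p \<in> schwartz" "q \<in> schwartz" "r \<in> schwartz" "p' \<in> schwartz" "q' \<in> schwartz" "r' \<in> schwartz"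
  shows "pairing (vec3 a b c) (\<lambda>x. \<alpha> *\<^sub>R vec3 p q r x + \<beta> *\<^sub>R vec3 p' q' r' x)
     = \<alpha> * pairing (vec3 a b c) (vec3 p q r) + \<beta> * pairing (vec3 a b c) (vec3 p' q' r')"
proof -
  have i: "integrable lborel (\<lambda>x. p x * a x + q x * b x + r x * c x)"
     "integrable lborel (\<lambda>x. p' x * a x + q' x * b x + r' x * c x)"
    by (intro schwartz_integrable schwartz_add schwartz_mult assms)+
  have v: "(\<lambda>x. \<alpha> *\<^sub>R vec3 p q r x + \<beta> *\<^sub>R vec3 p' q' r' x)
    = vec3 (\<lambda>x. \<alpha> * p x + \<beta> * p' x) (\<lambda>x. \<alpha> * q x + \<beta> * q' x) (\<lambda>x. \<alpha> * r x + \<beta> * r' x)"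
    by (simp add: fun_eq_iff vec_eq_iff forall_3)
  have "(\<lambda>x. (\<alpha> * p x + \<beta> * p' x) * a x + (\<alpha> * q x + \<beta> * q' x) * b x + (\<alpha> * r x + \<beta> * r' x) * c x)
     = (\<lambda>x. \<alpha> * (p x * a x + q x * b x + r x * c x) + \<beta> * (p' x * a x + q' x * b x + r' x * c x))"
    by (simp add: algebra_simps)
  then show ?thesis
    unfolding v pairing_vec3 using integral_lincomb[OF i, of \<alpha> \<beta>] by simp
qed

lemma J1_vec3: "J1 U (vec3 a b c) = vec3 (\<lambda>x. 1/2 * deriv a x) (\<lambda>x. - deriv (deriv c) x) (deriv (deriv b))"
  by (simp add: J1_def)

text \<open>The last two components grow linearly, so the usual potentials b' c - b c' do not decay.
  Instead each such component is written as \<open>pinv 2\<close> of its second derivative, and the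
  symmetry of \<open>pinv 2\<close> applies; only the first component is integrated by
  parts.\<close>

lemma J1_skew:
  assumes "\<xi> \<in> covectors" "\<eta> \<in> covectors"
  shows "pairing \<xi> (J1 U \<eta>) = - pairing \<eta> (J1 U \<xi>)"
proof -
  obtain a b c where \<xi>: "\<xi> = vec3 a b c" "a \<in> schwartz" "b \<in> tempered" "c \<in> tempered"
    and B: "deriv (deriv b) \<in> schwartz" "deriv (deriv c) \<in> schwartz"
      "pinv 2 (deriv (deriv b)) = b" "pinv 2 (deriv (deriv c)) = c"
    using covectorsE[OF assms(1)] .
  obtain a' b' c' where \<eta>: "\<eta> = vec3 a' b' c'" "a' \<in> schwartz" "b' \<in> tempered" "c' \<in> tempered"
    and B': "deriv (deriv b') \<in> schwartz" "deriv (deriv c') \<in> schwartz"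
      "pinv 2 (deriv (deriv b')) = b'" "pinv 2 (deriv (deriv c')) = c'"
    using covectorsE[OF assms(2)] .
  have split: "pairing (vec3 p q r) (J1 U (vec3 p' q' r'))
      = 1/2 * (LBINT x. deriv p' x * p x) - (LBINT x. deriv (deriv r') x * q x) + (LBINT x. deriv (deriv q') x * r x)"
    if "p \<in> schwartz" "q \<in> tempered" "r \<in> tempered" "p' \<in> schwartz"
      "deriv (deriv q') \<in> schwartz" "deriv (deriv r') \<in> schwartz" for p q r p' q' r'
  proof -
    have "integrable lborel (\<lambda>x. deriv p' x * p x)" "integrable lborel (\<lambda>x. deriv (deriv r') x * q x)"
      "integrable lborel (\<lambda>x. deriv (deriv q') x * r x)"
      by (intro schwartz_integrable schwartz_mult schwartz_deriv[of p'] that that(1)[THEN schwartz_imp_tempered])+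
    then show ?thesis unfolding J1_vec3 pairing_vec3 by simp
  qed
  have "(LBINT x. deriv a' x * a x) = (LBINT x. - (deriv a x * a' x))"
  proof (rule integral_eq_mod_deriv)
    show "(\<lambda>x. a x * a' x) \<in> schwartz" "(\<lambda>x. deriv a' x * a x) \<in> schwartz" "(\<lambda>x. - (deriv a x * a' x)) \<in> schwartz"
      by (intro schwartz_uminus schwartz_mult schwartz_deriv \<xi>(2) \<eta>(2)
            \<xi>(2)[THEN schwartz_imp_tempered] \<eta>(2)[THEN schwartz_imp_tempered])+
    show "((\<lambda>x. a x * a' x) has_real_derivative deriv a' x * a x - - (deriv a x * a' x)) (at x)" for x
      using DERIV_mult[OF schwartz_DERIV[OF \<xi>(2)] schwartz_DERIV[OF \<eta>(2)], of x] by (simp add: algebra_simps)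
  qed
  moreover have "(LBINT x. deriv (deriv c') x * b x) = (LBINT x. deriv (deriv b) x * c' x)"
    using pinv2_symmetric[OF B(1) B'(2)] B B' by simp
  moreover have "(LBINT x. deriv (deriv b') x * c x) = (LBINT x. deriv (deriv c) x * b' x)"
    using pinv2_symmetric[OF B(2) B'(1)] B B' by simp
  ultimately show ?thesis
    unfolding \<xi>(1) \<eta>(1) using split[OF \<xi>(2-4) \<eta>(2) B'(1,2)] split[OF \<eta>(2-4) \<xi>(2) B(1,2)] by simp
qed

text \<open>An operator independent of the state has derivative 0, so each term of its Jacobi
  identity vanishes separately.\<close>

lemma hamiltonian_J1: "hamiltonian_operator (\<lambda>U. covectors) J1"
proof -
  have "dir_deriv J1 U h \<zeta> = (\<lambda>x. 0)" for U h \<zeta>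
    unfolding dir_deriv_def J1_def by simp
  moreover have "pairing \<xi> (\<lambda>x. 0) = 0" for \<xi> by (simp add: pairing_def)
  ultimately show ?thesis
    unfolding hamiltonian_operator_def by (metis J1_skew add_0)
qed

lemma K1_value_comp_schwartz:
  assumes "u \<in> schwartz" "v \<in> schwartz" "w \<in> schwartz" "K1_covector u v w a b c F f"
  shows "comp (K1_value u v w b c F f) i \<in> schwartz"
proof -
  note t = K1_covector_tempered[OF assms(4)]
  have "\<forall>i. comp (K1_value u v w b c F f) i \<in> schwartz"
    unfolding forall_3 K1_value_def comp_vec3
    by (intro conjI schwartz_intros tempered_deriv zero_less_numeral assms t)
  then show ?thesis by blast
qed

lemma vec3_comp: "vec3 (comp U 1) (comp U 2) (comp U 3) = U"
  by (simp add: fun_eq_iff vec_eq_iff forall_3 comp_def)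

lemma variation_density_lincomb:
  "variation_density u a1 b1 c1 F1 f1 a3 b3 c3 F3 f3
     (\<lambda>x. \<alpha> * p x + \<beta> * p' x) (\<lambda>x. \<alpha> * q x + \<beta> * q' x) (\<lambda>x. \<alpha> * r x + \<beta> * r' x) x
   = \<alpha> * variation_density u a1 b1 c1 F1 f1 a3 b3 c3 F3 f3 p q r x
     + \<beta> * variation_density u a1 b1 c1 F1 f1 a3 b3 c3 F3 f3 p' q' r' x"
  unfolding variation_density_def by algebra

text \<open>With weights 0 and 1 this is \<open>K1\<close>, so a single Jacobi identity yields both
  the Hamiltonian property of \<open>K1\<close> and the compatibility with
  \<open>J1\<close>.\<close>

definition J1_K1_pencil :: "real \<Rightarrow> real \<Rightarrow> operator3" where
  "J1_K1_pencil \<alpha> \<beta> U \<xi> x = \<alpha> *\<^sub>R J1 U \<xi> x + \<beta> *\<^sub>R K1 U \<xi> x"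

text \<open>Only the \<open>K1\<close> part depends on the state, whence the outer factor \<beta>;
  the inner weights are those of the direction, in which the density is linear. The conditions on b2
  and c2 make the \<open>J1\<close> part of that direction Schwartz.\<close>

lemma pairing_dir_deriv_pencil:
  fixes \<alpha> \<beta> :: real
  assumes U: "u \<in> schwartz" "v \<in> schwartz" "w \<in> schwartz"
    and 1: "K1_covector u v w a1 b1 c1 F1 f1" and 2: "K1_covector u v w a2 b2 c2 F2 f2"
    and 3: "K1_covector u v w a3 b3 c3 F3 f3"
    and B2: "deriv (deriv b2) \<in> schwartz" "deriv (deriv c2) \<in> schwartz"
  defines "h \<equiv> K1_value u v w b2 c2 F2 f2"
  defines "D \<equiv> \<lambda>x. \<beta> * (
      \<alpha> * variation_density u a1 b1 c1 F1 f1 a3 b3 c3 F3 f3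
           (\<lambda>x. 1/2 * deriv a2 x) (\<lambda>x. - deriv (deriv c2) x) (deriv (deriv b2)) x
    + \<beta> * variation_density u a1 b1 c1 F1 f1 a3 b3 c3 F3 f3 (comp h 1) (comp h 2) (comp h 3) x)"
  shows "D \<in> schwartz"
    "pairing (vec3 a1 b1 c1) (dir_deriv (J1_K1_pencil \<alpha> \<beta>) (vec3 u v w)
        (J1_K1_pencil \<alpha> \<beta> (vec3 u v w) (vec3 a2 b2 c2)) (vec3 a3 b3 c3)) = (LBINT x. D x)"
proof -
  have J: "(\<lambda>x. 1/2 * deriv a2 x) \<in> schwartz" "(\<lambda>x. - deriv (deriv c2) x) \<in> schwartz"
    by (intro schwartz_cmult schwartz_uminus B2 schwartz_deriv K1_covectorD[OF 2])+
  have K: "comp h i \<in> schwartz" for i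
    unfolding h_def by (rule K1_value_comp_schwartz[OF U 2])
  show D: "D \<in> schwartz"
    unfolding D_def
    by (intro schwartz_cmult schwartz_add variation_density_schwartz[OF U(1) 1 3] J K B2)
  define p q r where "p x = \<alpha> * (1/2 * deriv a2 x) + \<beta> * comp h 1 x"
    and "q x = \<alpha> * (- deriv (deriv c2) x) + \<beta> * comp h 2 x"
    and "r x = \<alpha> * deriv (deriv b2) x + \<beta> * comp h 3 x" for x
  have pqr: "p \<in> schwartz" "q \<in> schwartz" "r \<in> schwartz"
    unfolding p_def[abs_def] q_def[abs_def] r_def[abs_def]
    by (intro schwartz_add schwartz_cmult[OF J(1)] schwartz_cmult[OF J(2)] schwartz_cmult[OF K] schwartz_cmult[OF B2(1)])+
  have H: "J1_K1_pencil \<alpha> \<beta> (vec3 u v w) (vec3 a2 b2 c2) = vec3 p q r"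
    unfolding J1_K1_pencil_def[abs_def] K1_covector_K1[OF 2 U] J1_vec3 h_def[symmetric] p_def q_def r_def
    by (simp add: fun_eq_iff vec_eq_iff forall_3 comp_def)
  let ?M = "pinv 1 (\<lambda>x. q x * b3 x - r x * c3 x)" and ?k = "pinv 3 (density_Omega_adj p q r a3 b3 c3)"
  let ?V = "K1_variation u v w p q r b3 c3 F3 ?M f3 ?k"
  have V: "dir_deriv (J1_K1_pencil \<alpha> \<beta>) (vec3 u v w) (vec3 p q r) (vec3 a3 b3 c3) = (\<lambda>x. \<beta> *\<^sub>R ?V x)"
    unfolding dir_deriv_def J1_K1_pencil_def
      K1_vec3_shift[OF U pqr K1_covector_tempered(1-3)[OF 3]] K1_covector_pinv[OF 3] J1_vec3
  proof (rule ext, rule vector_derivative_at)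
    fix x
    show "((\<lambda>e. \<alpha> *\<^sub>R vec3 (\<lambda>x. 1 / 2 * deriv a3 x) (\<lambda>x. - deriv (deriv c3) x) (deriv (deriv b3)) x +
        \<beta> *\<^sub>R (K1_value u v w b3 c3 F3 f3 x + e *\<^sub>R ?V x + e\<^sup>2 *\<^sub>R K1_value p q r b3 c3 ?M ?k x))
        has_vector_derivative \<beta> *\<^sub>R ?V x) (at 0)"
      by (auto intro!: derivative_eq_intros)
  qed
  have "pairing (vec3 a1 b1 c1) (\<lambda>x. \<beta> *\<^sub>R ?V x) = \<beta> * pairing (vec3 a1 b1 c1) ?V"
    unfolding pairing_def by simp
  also have "\<dots> = (LBINT x. \<beta> * variation_density u a1 b1 c1 F1 f1 a3 b3 c3 F3 f3 p q r x)"
    using pairing_K1_variation[OF U pqr 1 3] by simp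
  also have "\<dots> = (LBINT x. D x)"
    unfolding D_def p_def q_def r_def variation_density_lincomb ..
  finally show "pairing (vec3 a1 b1 c1) (dir_deriv (J1_K1_pencil \<alpha> \<beta>) (vec3 u v w)
        (J1_K1_pencil \<alpha> \<beta> (vec3 u v w) (vec3 a2 b2 c2)) (vec3 a3 b3 c3)) = (LBINT x. D x)"
    unfolding H V .
qed

lemma K1_skew:
  assumes U: "u \<in> schwartz" "v \<in> schwartz" "w \<in> schwartz"
    and "\<xi> \<in> K1_domain (vec3 u v w)" "\<eta> \<in> K1_domain (vec3 u v w)"
  shows "pairing \<xi> (K1 (vec3 u v w) \<eta>) = - pairing \<eta> (K1 (vec3 u v w) \<xi>)"
proof -
  obtain a b c F f where \<xi>: "\<xi> = vec3 a b c" "K1_covector u v w a b c F f"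
    using K1_domainE[OF assms(4) U(2,3)] by metis
  obtain a' b' c' F' f' where \<eta>: "\<eta> = vec3 a' b' c'" "K1_covector u v w a' b' c' F' f'"
    using K1_domainE[OF assms(5) U(2,3)] by metis
  show ?thesis
    unfolding \<xi>(1) \<eta>(1) K1_covector_K1[OF \<xi>(2) U] K1_covector_K1[OF \<eta>(2) U]
    by (rule K1_covector_skew[OF U \<xi>(2) \<eta>(2)])
qed

lemma pairing_pencil:
  assumes U: "u \<in> schwartz" "v \<in> schwartz" "w \<in> schwartz"
    and "\<xi> \<in> K1_domain (vec3 u v w)" "\<eta> \<in> K1_domain (vec3 u v w)"
  shows "pairing \<xi> (J1_K1_pencil \<alpha> \<beta> (vec3 u v w) \<eta>)
     = \<alpha> * pairing \<xi> (J1 (vec3 u v w) \<eta>) + \<beta> * pairing \<xi> (K1 (vec3 u v w) \<eta>)"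
proof -
  obtain a b c F f where \<xi>: "\<xi> = vec3 a b c" "K1_covector u v w a b c F f"
    using K1_domainE[OF assms(4) U(2,3)] by metis
  obtain a' b' c' F' f' where \<eta>: "\<eta> = vec3 a' b' c'" "K1_covector u v w a' b' c' F' f'"
    and B: "deriv (deriv b') \<in> schwartz" "deriv (deriv c') \<in> schwartz"
    using K1_domainE[OF assms(5) U(2,3)] .
  let ?h = "K1_value u v w b' c' F' f'"
  have J: "(\<lambda>x. 1/2 * deriv a' x) \<in> schwartz" "(\<lambda>x. - deriv (deriv c') x) \<in> schwartz"
    by (intro schwartz_cmult schwartz_uminus B schwartz_deriv K1_covectorD[OF \<eta>(2)])+
  show ?thesis
    unfolding J1_K1_pencil_def[abs_def] \<xi>(1) \<eta>(1) K1_covector_K1[OF \<eta>(2) U] J1_vec3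
    using pairing_lincomb[OF K1_covector_tempered(1-3)[OF \<xi>(2)] J B(1)
        K1_value_comp_schwartz[OF U \<eta>(2), of 1] K1_value_comp_schwartz[OF U \<eta>(2), of 2]
        K1_value_comp_schwartz[OF U \<eta>(2), of 3], of \<alpha> \<beta>]
    unfolding vec3_comp .
qed

lemma hamiltonian_pencil: "hamiltonian_operator K1_domain (J1_K1_pencil \<alpha> \<beta>)"
  unfolding hamiltonian_operator_def
proof (intro ballI conjI)
  fix U assume "U \<in> schwartz3"
  then obtain u v w where Ueq: "U = vec3 u v w" and U: "u \<in> schwartz" "v \<in> schwartz" "w \<in> schwartz"
    unfolding schwartz3_def by blast
  fix \<xi> \<eta> assume d: "\<xi> \<in> K1_domain U" "\<eta> \<in> K1_domain U"
  then have "\<xi> \<in> covectors" "\<eta> \<in> covectors" by (auto simp: K1_domain_def)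
  then have "pairing \<xi> (J1 U \<eta>) = - pairing \<eta> (J1 U \<xi>)" by (rule J1_skew)
  moreover have "pairing \<xi> (K1 U \<eta>) = - pairing \<eta> (K1 U \<xi>)"
    using d unfolding Ueq by (rule K1_skew[OF U])
  ultimately show "pairing \<xi> (J1_K1_pencil \<alpha> \<beta> U \<eta>) = - pairing \<eta> (J1_K1_pencil \<alpha> \<beta> U \<xi>)"
    using pairing_pencil[OF U, of \<xi> \<eta> \<alpha> \<beta>] pairing_pencil[OF U, of \<eta> \<xi> \<alpha> \<beta>] d unfolding Ueq by simp
  fix \<zeta> assume z: "\<zeta> \<in> K1_domain U"
  obtain a1 b1 c1 F1 f1 where \<xi>: "\<xi> = vec3 a1 b1 c1" and 1: "K1_covector u v w a1 b1 c1 F1 f1"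
    and B1: "deriv (deriv b1) \<in> schwartz" "deriv (deriv c1) \<in> schwartz"
    using K1_domainE[OF d(1)[unfolded Ueq] U(2,3)] .
  obtain a2 b2 c2 F2 f2 where \<eta>: "\<eta> = vec3 a2 b2 c2" and 2: "K1_covector u v w a2 b2 c2 F2 f2"
    and B2: "deriv (deriv b2) \<in> schwartz" "deriv (deriv c2) \<in> schwartz"
    using K1_domainE[OF d(2)[unfolded Ueq] U(2,3)] .
  obtain a3 b3 c3 F3 f3 where \<zeta>: "\<zeta> = vec3 a3 b3 c3" and 3: "K1_covector u v w a3 b3 c3 F3 f3"
    and B3: "deriv (deriv b3) \<in> schwartz" "deriv (deriv c3) \<in> schwartz"
    using K1_domainE[OF z[unfolded Ueq] U(2,3)] .
  note D1 = pairing_dir_deriv_pencil[OF U 1 2 3 B2, where \<alpha> = \<alpha> and \<beta> = \<beta>]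
    and D2 = pairing_dir_deriv_pencil[OF U 2 3 1 B3, where \<alpha> = \<alpha> and \<beta> = \<beta>]
    and D3 = pairing_dir_deriv_pencil[OF U 3 1 2 B1, where \<alpha> = \<alpha> and \<beta> = \<beta>]
  note GJ = J1_cyclic_density[OF 1 2 3] and GK = K1_cyclic_density[OF U 1 2 3]
  \<comment> \<open>The potentials of the two cyclic sums combine with the same weights as the
    densities.\<close>
  have G: "((\<lambda>x. \<beta> * (\<alpha> * gJ x + \<beta> * gK x)) has_real_derivative
      \<beta> * (\<alpha> * j1 + \<beta> * k1) + \<beta> * (\<alpha> * j2 + \<beta> * k2) + \<beta> * (\<alpha> * j3 + \<beta> * k3)) (at x)"
    if "(gJ has_real_derivative j1 + j2 + j3) (at x)" "(gK has_real_derivative k1 + k2 + k3) (at x)"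
    for gJ gK j1 j2 j3 k1 k2 k3 x
    by (rule DERIV_cong, (rule derivative_intros that)+) algebra
  show "pairing \<xi> (dir_deriv (J1_K1_pencil \<alpha> \<beta>) U (J1_K1_pencil \<alpha> \<beta> U \<eta>) \<zeta>) +
      pairing \<eta> (dir_deriv (J1_K1_pencil \<alpha> \<beta>) U (J1_K1_pencil \<alpha> \<beta> U \<zeta>) \<xi>) +
      pairing \<zeta> (dir_deriv (J1_K1_pencil \<alpha> \<beta>) U (J1_K1_pencil \<alpha> \<beta> U \<xi>) \<eta>) = 0"
    unfolding \<xi> \<eta> \<zeta> Ueq D1(2) D2(2) D3(2)
      Bochner_Integration.integral_add[OF schwartz_integrable[OF D1(1)] schwartz_integrable[OF D2(1)], symmetric]
      Bochner_Integration.integral_add[OF schwartz_integrable[OF schwartz_add[OF D1(1) D2(1)]]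
        schwartz_integrable[OF D3(1)], symmetric]
    by (rule integral_schwartz_deriv[OF G[OF GJ(2) GK(2)]
          schwartz_cmult[OF schwartz_add[OF schwartz_cmult[OF GJ(1)] schwartz_cmult[OF GK(1)]]]])
qed

lemma bi_hamiltonian_pair_J1_K1: "bi_hamiltonian_pair (\<lambda>U. covectors) J1 K1_domain K1"
  unfolding bi_hamiltonian_pair_def
proof (intro conjI allI hamiltonian_J1)
  have "K1 = J1_K1_pencil 0 1" by (simp add: fun_eq_iff J1_K1_pencil_def)
  then show "hamiltonian_operator K1_domain K1" by (metis hamiltonian_pencil)
  have "covectors \<inter> K1_domain U = K1_domain U" for U by (auto simp: K1_domain_def)
  then show "hamiltonian_operator (\<lambda>U. covectors \<inter> K1_domain U) (\<lambda>U \<xi> x. a *\<^sub>R J1 U \<xi> x + b *\<^sub>R K1 U \<xi> x)" for a b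
    using hamiltonian_pencil[of a b] by (simp add: J1_K1_pencil_def[abs_def])
qed

section \<open>Variational derivatives\<close>

abbreviation state :: "(real \<Rightarrow> real) \<Rightarrow> (real \<Rightarrow> real) \<Rightarrow> (real \<Rightarrow> real) \<Rightarrow> field3" where
  "state u p r \<equiv> vec3 u (\<lambda>x. - deriv (deriv p) x) (\<lambda>x. - deriv (deriv r) x)"

lemma statesE:
  assumes "U \<in> states"
  obtains u p r where "U = state u p r" "u \<in> schwartz" "p \<in> schwartz" "r \<in> schwartz"
  using assms unfolding states_def by blast

lemma potential_of_state:
  assumes "p \<in> schwartz" "r \<in> schwartz"
  shows "p_of (state u p r) = p" "r_of (state u p r) = r"
  using assms by (simp_all add: p_of_def r_of_def pinv_uminus pinv2_inverse)

lemma deriv_lincomb: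
  assumes "f \<in> schwartz" "g \<in> schwartz"
  shows "deriv (\<lambda>x. f x + e * g x) = (\<lambda>x. deriv f x + e * deriv g x)"
  by (rule ext, rule DERIV_imp_deriv)
     (rule derivative_intros schwartz_DERIV assms DERIV_cmult)+

lemma state_shift:
  assumes "p \<in> schwartz" "r \<in> schwartz" "P \<in> schwartz" "R \<in> schwartz"
  shows "(\<lambda>x. state u p r x + e *\<^sub>R state y P R x)
    = state (\<lambda>x. u x + e * y x) (\<lambda>x. p x + e * P x) (\<lambda>x. r x + e * R x)"
  using assms
  by (simp add: fun_eq_iff vec_eq_iff forall_3 deriv_lincomb schwartz_deriv)

text \<open>The symmetry of \<open>pinv 2\<close> moves it onto the variation, where it undoes a
  second derivative; the signs come from v = - p_xx and w = - r_xx. Thus - b and - c play the role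
  of derivatives with respect to p and r.\<close>

lemma pairing_state:
  assumes "a \<in> schwartz" "b \<in> schwartz" "c \<in> schwartz" "y \<in> schwartz" "P \<in> schwartz" "R \<in> schwartz"
  shows "pairing (vec3 a (pinv 2 b) (pinv 2 c)) (state y P R) = (LBINT x. y x * a x - P x * b x - R x * c x)"
proof -
  have sym: "(LBINT x. deriv (deriv Q) x * pinv 2 q x) = (LBINT x. Q x * q x)"
    if "Q \<in> schwartz" "q \<in> schwartz" for Q q
    using pinv2_symmetric[OF that(2) schwartz_deriv[OF schwartz_deriv[OF that(1)]]] pinv2_inverse[OF that(1)]
    by (simp add: mult.commute)
  have i: "integrable lborel (\<lambda>x. y x * a x)"
    "integrable lborel (\<lambda>x. deriv (deriv P) x * pinv 2 b x)" "integrable lborel (\<lambda>x. deriv (deriv R) x * pinv 2 c x)"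
    "integrable lborel (\<lambda>x. P x * b x)" "integrable lborel (\<lambda>x. R x * c x)"
    by (intro schwartz_integrable schwartz_mult schwartz_deriv pinv2_tempered assms
        assms(1-3)[THEN schwartz_imp_tempered])+
  show ?thesis
    unfolding pairing_vec3 using i sym[OF assms(5,2)] sym[OF assms(6,3)] by simp
qed

text \<open>The antiderivative \<open>pinv 1 f\<close> is nondecreasing and tends to 0 at both ends,
  so it vanishes identically.\<close>

lemma schwartz_nonneg_integral_0:
  assumes "f \<in> schwartz" "\<And>x. 0 \<le> f x" "(LBINT x. f x) = 0"
  shows "f x = 0"
proof -
  have mono: "pinv 1 f s \<le> pinv 1 f t" if "s \<le> t" for s t
    using DERIV_nonneg_imp_nondecreasing[OF that] pinv1_DERIV[OF assms(1)] assms(2) by blast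
  have lim: "(pinv 1 f \<longlongrightarrow> 0) at_top" "(pinv 1 f \<longlongrightarrow> 0) at_bot"
    using pinv1_tendsto[OF assms(1)] assms(3) by simp_all
  have "pinv 1 f t = 0" for t
  proof (rule antisym)
    show "pinv 1 f t \<le> 0"
      by (rule tendsto_lowerbound[OF lim(1)]) (auto intro!: eventually_at_top_linorderI[of t] mono simp del: One_nat_def)
    show "0 \<le> pinv 1 f t"
      by (rule tendsto_upperbound[OF lim(2)]) (auto intro!: eventually_at_bot_linorderI[of t] mono simp del: One_nat_def)
  qed
  then have "pinv 1 f = (\<lambda>t. 0)" by blast
  with pinv1_DERIV[OF assms(1), of x] show ?thesis
    using DERIV_unique[OF DERIV_const] by metis
qed

text \<open>The test variation is the difference of the two candidates, with the signs of
  \<open>pairing_state\<close> built in, so that the difference of the pairings is the integral of a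
  sum of three squares.\<close>

lemma has_var_deriv_unique:
  assumes "has_var_deriv H U g" "has_var_deriv H U g'"
  shows "g = g'"
proof -
  obtain a b c where g: "g = vec3 a (pinv 2 b) (pinv 2 c)" and s: "a \<in> schwartz" "b \<in> schwartz" "c \<in> schwartz"
    using assms(1) unfolding has_var_deriv_def covectors_def by blast
  obtain a' b' c' where g': "g' = vec3 a' (pinv 2 b') (pinv 2 c')" and s': "a' \<in> schwartz" "b' \<in> schwartz" "c' \<in> schwartz"
    using assms(2) unfolding has_var_deriv_def covectors_def by blast
  note t = s[THEN schwartz_imp_tempered] s'[THEN schwartz_imp_tempered]
  let ?\<phi> = "state (\<lambda>x. a x - a' x) (\<lambda>x. b' x - b x) (\<lambda>x. c' x - c x)"
  have d: "(\<lambda>x. a x - a' x) \<in> schwartz" "(\<lambda>x. b' x - b x) \<in> schwartz" "(\<lambda>x. c' x - c x) \<in> schwartz"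
    by (intro schwartz_diff s s')+
  then have "?\<phi> \<in> states" unfolding states_def by blast
  then have "pairing g ?\<phi> = pairing g' ?\<phi>"
    using assms unfolding has_var_deriv_def by (meson DERIV_unique)
  then have eq: "(LBINT x. (a x - a' x) * a x - (b' x - b x) * b x - (c' x - c x) * c x)
      = (LBINT x. (a x - a' x) * a' x - (b' x - b x) * b' x - (c' x - c x) * c' x)"
    unfolding g g' pairing_state[OF s d] pairing_state[OF s' d] .
  have i: "(\<lambda>x. (a x - a' x) * a x - (b' x - b x) * b x - (c' x - c x) * c x) \<in> schwartz"
     "(\<lambda>x. (a x - a' x) * a' x - (b' x - b x) * b' x - (c' x - c x) * c' x) \<in> schwartz"
    by (intro schwartz_diff schwartz_mult d s s' t)+
  let ?S = "\<lambda>x. (a x - a' x) * a x - (b' x - b x) * b x - (c' x - c x) * c x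
     - ((a x - a' x) * a' x - (b' x - b x) * b' x - (c' x - c x) * c' x)"
  have "(LBINT x. ?S x) = 0"
    using Bochner_Integration.integral_diff[OF i[THEN schwartz_integrable]] eq by simp
  moreover have S: "?S x = (a x - a' x)\<^sup>2 + (b x - b' x)\<^sup>2 + (c x - c' x)\<^sup>2" for x
    by algebra
  ultimately have "?S x = 0" for x
    using schwartz_nonneg_integral_0[OF schwartz_diff[OF i]] by simp
  then have "(a x - a' x)\<^sup>2 + (b x - b' x)\<^sup>2 + (c x - c' x)\<^sup>2 = 0" for x
    unfolding S .
  then have "a x = a' x \<and> b x = b' x \<and> c x = c' x" for x
    by (simp add: add_nonneg_eq_0_iff)
  then have "a = a'" "b = b'" "c = c'" by blast+
  then show ?thesis unfolding g g' by simp
qed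

lemma var_deriv_eq: "has_var_deriv H U g \<Longrightarrow> var_deriv H U = g"
  unfolding var_deriv_def using has_var_deriv_unique by blast

text \<open>Degree four suffices: the integrand of \<open>H1\<close> is quadratic and that of
  \<open>H2\<close> quartic in the state and its potentials.\<close>

lemma DERIV_integral_quartic:
  assumes c: "c0 \<in> schwartz" "c1 \<in> schwartz" "c2 \<in> schwartz" "c3 \<in> schwartz" "c4 \<in> schwartz"
    and H: "\<And>e. H e = (LBINT x. c0 x + e * c1 x + e\<^sup>2 * c2 x + e ^ 3 * c3 x + e ^ 4 * c4 x)"
  shows "(H has_real_derivative (LBINT x. c1 x)) (at 0)"
proof -
  have "H = (\<lambda>e. (LBINT x. c0 x) + e * (LBINT x. c1 x) + e\<^sup>2 * (LBINT x. c2 x)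
      + e ^ 3 * (LBINT x. c3 x) + e ^ 4 * (LBINT x. c4 x))"
    unfolding H using c[THEN schwartz_integrable] by (intro ext) simp
  then show ?thesis by (auto intro!: derivative_eq_intros)
qed

text \<open>Varying p in the integral of p_x r_x gives - r_xx, and minus \<open>pinv 2\<close> of
  this is r, the derivative with respect to v. The roles of p and r are symmetric.\<close>

lemma has_var_deriv_H1:
  assumes "u \<in> schwartz" and p: "p \<in> schwartz" and r: "r \<in> schwartz"
  shows "has_var_deriv H1 (state u p r) (vec3 (\<lambda>x. 0) r p)"
  unfolding has_var_deriv_def
proof (intro conjI ballI)
  have g: "vec3 (\<lambda>x. 0) r p = vec3 (\<lambda>x. 0) (pinv 2 (deriv (deriv r))) (pinv 2 (deriv (deriv p)))"
    by (simp add: pinv2_inverse p r)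
  show "vec3 (\<lambda>x. 0) r p \<in> covectors"
    unfolding g covectors_def using p r schwartz_deriv schwartz_zero by blast
  fix \<phi> assume "\<phi> \<in> states"
  then obtain y P R where \<phi>: "\<phi> = state y P R" and y: "y \<in> schwartz" and P: "P \<in> schwartz" and R: "R \<in> schwartz"
    by (rule statesE)
  note s = y P R p r
  note t = s[THEN schwartz_imp_tempered]
  have "pairing (vec3 (\<lambda>x. 0) r p) \<phi> = (LBINT x. y x * 0 - P x * deriv (deriv r) x - R x * deriv (deriv p) x)"
    unfolding g \<phi> by (intro pairing_state s schwartz_deriv schwartz_zero)
  also have "\<dots> = (LBINT x. deriv P x * deriv r x + deriv R x * deriv p x)"
  proof (rule integral_eq_mod_deriv)
    show "(\<lambda>x. - P x * deriv r x - R x * deriv p x) \<in> schwartz"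
      "(\<lambda>x. deriv P x * deriv r x + deriv R x * deriv p x) \<in> schwartz"
      "(\<lambda>x. y x * 0 - P x * deriv (deriv r) x - R x * deriv (deriv p) x) \<in> schwartz"
      by (intro schwartz_add schwartz_diff schwartz_uminus schwartz_mult schwartz_deriv tempered_deriv tempered_const s t)+
    show "((\<lambda>x. - P x * deriv r x - R x * deriv p x) has_real_derivative
       y x * 0 - P x * deriv (deriv r) x - R x * deriv (deriv p) x
       - (deriv P x * deriv r x + deriv R x * deriv p x)) (at x)" for x
      by (rule DERIV_cong, (rule derivative_intros tempered_DERIV tempered_deriv t)+) algebra
  qed
  also have "((\<lambda>e. H1 (\<lambda>x. state u p r x + e *\<^sub>R \<phi> x)) has_real_derivative \<dots>) (at 0)"
  proof (rule DERIV_integral_quartic)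
    show "H1 (\<lambda>x. state u p r x + e *\<^sub>R \<phi> x) = (LBINT x. deriv p x * deriv r x
       + e * (deriv P x * deriv r x + deriv R x * deriv p x) + e\<^sup>2 * (deriv P x * deriv R x)
       + e ^ 3 * 0 + e ^ 4 * 0)" for e
      unfolding H1_def \<phi> state_shift[OF p r P R]
      unfolding potential_of_state[OF schwartz_lincomb[OF p P] schwartz_lincomb[OF r R]]
      unfolding deriv_lincomb[OF p P] deriv_lincomb[OF r R]
      by (simp add: power2_eq_square algebra_simps)
  qed (intro schwartz_add schwartz_mult schwartz_deriv tempered_deriv schwartz_zero s t)+
  finally show "((\<lambda>e. H1 (\<lambda>x. state u p r x + e *\<^sub>R \<phi> x)) has_real_derivative pairing (vec3 (\<lambda>x. 0) r p) \<phi>) (at 0)" .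
qed

text \<open>The derivatives of \<open>H2\<close> with respect to p and r. The first two terms of its
  density are (p^2/2)_x (r^2/2)_xx, and 3 r_x r_xx + r r_xxx = (r^2/2)_xxx. One integration by parts
  frees p and two free r, hence the opposite signs.\<close>

definition H2_grad_p where
  "H2_grad_p u p r x = - p x * (3 * deriv r x * deriv (deriv r) x + r x * deriv (deriv (deriv r)) x) - (u x)\<^sup>2 * r x"

definition H2_grad_r where
  "H2_grad_r u p r x = r x * (3 * deriv p x * deriv (deriv p) x + p x * deriv (deriv (deriv p)) x) - (u x)\<^sup>2 * p x"

lemma H2_grad_schwartz:
  assumes "u \<in> schwartz" "p \<in> schwartz" "r \<in> schwartz"
  shows "H2_grad_p u p r \<in> schwartz" "H2_grad_r u p r \<in> schwartz"
  unfolding H2_grad_p_def[abs_def] H2_grad_r_def[abs_def]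
  by (intro schwartz_diff schwartz_uminus schwartz_mult schwartz_power zero_less_numeral
      tempered_const tempered_deriv tempered_add tempered_mult assms assms[THEN schwartz_imp_tempered])+

lemma has_var_deriv_H2:
  assumes u: "u \<in> schwartz" and p: "p \<in> schwartz" and r: "r \<in> schwartz"
  shows "has_var_deriv H2 (state u p r)
    (vec3 (\<lambda>x. - 2 * u x * p x * r x) (pinv 2 (\<lambda>x. - H2_grad_p u p r x)) (pinv 2 (\<lambda>x. - H2_grad_r u p r x)))"
    (is "has_var_deriv _ _ ?g")
  unfolding has_var_deriv_def
proof (intro conjI ballI)
  have upr: "(\<lambda>x. - 2 * u x * p x * r x) \<in> schwartz"
    by (intro schwartz_cmult schwartz_mult u p[THEN schwartz_imp_tempered] r[THEN schwartz_imp_tempered])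
  note grad = schwartz_uminus[OF H2_grad_schwartz(1)[OF assms]] schwartz_uminus[OF H2_grad_schwartz(2)[OF assms]]
  show "?g \<in> covectors"
    unfolding covectors_def using upr grad by blast
  fix \<phi> assume "\<phi> \<in> states"
  then obtain y P R where \<phi>: "\<phi> = state y P R" and y: "y \<in> schwartz" and P: "P \<in> schwartz" and R: "R \<in> schwartz"
    by (rule statesE)
  note s = y P R u p r
  note t = s[THEN schwartz_imp_tempered]
  note S = schwartz_add schwartz_diff schwartz_cmult schwartz_mult schwartz_power zero_less_numeral
    schwartz_deriv tempered_deriv tempered_power s t
  \<comment> \<open>The factors p p_x, r r_xx + r_x^2, p r and u^2 of the density are expanded along
    the variation; the index is the power of the parameter.\<close>
  define a0 a1 a2 where "a0 x = p x * deriv p x" and "a1 x = p x * deriv P x + P x * deriv p x"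
    and "a2 x = P x * deriv P x" for x
  define b0 b1 b2 where "b0 x = r x * deriv (deriv r) x + (deriv r x)\<^sup>2"
    and "b1 x = r x * deriv (deriv R) x + R x * deriv (deriv r) x + 2 * deriv r x * deriv R x"
    and "b2 x = R x * deriv (deriv R) x + (deriv R x)\<^sup>2" for x
  define d0 d1 d2 where "d0 x = p x * r x" and "d1 x = p x * R x + P x * r x" and "d2 x = P x * R x" for x
  define e0 e1 e2 where "e0 x = (u x)\<^sup>2" and "e1 x = 2 * u x * y x" and "e2 x = (y x)\<^sup>2" for x
  have abs: "a0 \<in> schwartz" "a1 \<in> schwartz" "a2 \<in> schwartz" "b0 \<in> schwartz" "b1 \<in> schwartz" "b2 \<in> schwartz"
    "d0 \<in> schwartz" "d1 \<in> schwartz" "d2 \<in> schwartz" "e0 \<in> schwartz" "e1 \<in> schwartz" "e2 \<in> schwartz"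
    unfolding a0_def[abs_def] a1_def[abs_def] a2_def[abs_def] b0_def[abs_def] b1_def[abs_def] b2_def[abs_def]
      d0_def[abs_def] d1_def[abs_def] d2_def[abs_def] e0_def[abs_def] e1_def[abs_def] e2_def[abs_def]
    by (intro S)+
  note abt = abs[THEN schwartz_imp_tempered]
  let ?c1 = "\<lambda>x. a0 x * b1 x + a1 x * b0 x - e0 x * d1 x - e1 x * d0 x"
  have "pairing ?g \<phi> = (LBINT x. y x * (- 2 * u x * p x * r x) - P x * (- H2_grad_p u p r x) - R x * (- H2_grad_r u p r x))"
    unfolding \<phi> by (intro pairing_state upr grad s)
  also have "\<dots> = (LBINT x. ?c1 x)"
  proof (rule integral_eq_mod_deriv[symmetric])
    \<comment> \<open>Since \<open>a1\<close> is (p P)' and \<open>b1\<close> is (r R)'', one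
      partial integration removes the derivative from P and two remove those from R.\<close>
    let ?G = "\<lambda>x. p x * P x * (r x * deriv (deriv r) x + (deriv r x)\<^sup>2)
       + p x * deriv p x * (r x * deriv R x + R x * deriv r x)
       - r x * R x * (p x * deriv (deriv p) x + (deriv p x)\<^sup>2)"
    show "?c1 \<in> schwartz" by (intro schwartz_add schwartz_diff schwartz_mult abs abt)
    show "(\<lambda>x. y x * (- 2 * u x * p x * r x) - P x * (- H2_grad_p u p r x) - R x * (- H2_grad_r u p r x)) \<in> schwartz"
      by (intro schwartz_diff schwartz_mult upr grad s schwartz_imp_tempered[OF upr] schwartz_imp_tempered[OF grad(1)]
            schwartz_imp_tempered[OF grad(2)])
    show "?G \<in> schwartz"
      by (intro schwartz_add schwartz_diff schwartz_mult tempered_add tempered_mult tempered_power tempered_deriv s t)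
    show "(?G has_real_derivative ?c1 x
        - (y x * (- 2 * u x * p x * r x) - P x * (- H2_grad_p u p r x) - R x * (- H2_grad_r u p r x))) (at x)" for x
      unfolding a0_def a1_def b0_def b1_def d0_def d1_def e0_def e1_def H2_grad_p_def H2_grad_r_def
      by (rule DERIV_cong, (rule derivative_intros tempered_DERIV tempered_deriv t)+)
         (simp add: algebra_simps power2_eq_square)
  qed
  also have "((\<lambda>e. H2 (\<lambda>x. state u p r x + e *\<^sub>R \<phi> x)) has_real_derivative \<dots>) (at 0)"
  proof (rule DERIV_integral_quartic)
    let ?c2 = "\<lambda>x. a0 x * b2 x + a1 x * b1 x + a2 x * b0 x - e0 x * d2 x - e1 x * d1 x - e2 x * d0 x"
    let ?c3 = "\<lambda>x. a1 x * b2 x + a2 x * b1 x - e1 x * d2 x - e2 x * d1 x"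
    let ?c4 = "\<lambda>x. a2 x * b2 x - e2 x * d2 x"
    show "H2 (\<lambda>x. state u p r x + e *\<^sub>R \<phi> x) = (LBINT x. (a0 x * b0 x - e0 x * d0 x)
       + e * ?c1 x + e\<^sup>2 * ?c2 x + e ^ 3 * ?c3 x + e ^ 4 * ?c4 x)" for e
      unfolding H2_def Let_def \<phi> state_shift[OF p r P R]
      unfolding potential_of_state[OF schwartz_lincomb[OF p P] schwartz_lincomb[OF r R]]
      unfolding deriv_lincomb[OF p P] deriv_lincomb[OF r R] deriv_lincomb[OF schwartz_deriv[OF r] schwartz_deriv[OF R]] comp_vec3
    proof (rule Bochner_Integration.integral_cong[OF refl])
      fix x
      show "(p x + e * P x) * (deriv p x + e * deriv P x) * (r x + e * R x) * (deriv (deriv r) x + e * deriv (deriv R) x)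
          + (p x + e * P x) * (deriv p x + e * deriv P x) * (deriv r x + e * deriv R x)\<^sup>2
          - (u x + e * y x)\<^sup>2 * (p x + e * P x) * (r x + e * R x)
        = (a0 x * b0 x - e0 x * d0 x) + e * ?c1 x + e\<^sup>2 * ?c2 x + e ^ 3 * ?c3 x + e ^ 4 * ?c4 x"
        unfolding a0_def a1_def a2_def b0_def b1_def b2_def d0_def d1_def d2_def e0_def e1_def e2_def
        by algebra
    qed
  qed (intro schwartz_add schwartz_diff schwartz_mult abs abt)+
  finally show "((\<lambda>e. H2 (\<lambda>x. state u p r x + e *\<^sub>R \<phi> x)) has_real_derivative pairing ?g \<phi>) (at 0)" .
qed

section \<open>The Hamiltonian flows\<close>

text \<open>The system solved for the time derivatives, with v = - p_xx and w = - r_xx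
  inserted.\<close>

definition limit_flow where
  "limit_flow u p r = vec3 (\<lambda>x. - deriv (\<lambda>y. u y * p y * r y) x)
     (\<lambda>x. 3 * deriv (deriv p) x * deriv p x * r x + deriv (deriv (deriv p)) x * p x * r x - (u x)\<^sup>2 * p x)
     (\<lambda>x. 3 * deriv (deriv r) x * p x * deriv r x + deriv (deriv (deriv r)) x * p x * r x + (u x)\<^sup>2 * r x)"

text \<open>At the gradient (0, r, p) of \<open>H1\<close> the inverse derivatives in
  \<open>K1\<close> become explicit: v r - w p is the derivative of the Wronskian of p and r, and
  \<open>Omega_adj\<close> gives half the third derivative of p r. This is why the resulting flow is
  local.\<close>

lemma K1_covector_H1:
  assumes u: "u \<in> schwartz" and p: "p \<in> schwartz" and r: "r \<in> schwartz"
  shows "K1_covector u (\<lambda>x. - deriv (deriv p) x) (\<lambda>x. - deriv (deriv r) x) (\<lambda>x. 0) r p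
     (\<lambda>x. p x * deriv r x - deriv p x * r x) (\<lambda>x. 1/2 * (p x * r x))"
proof -
  note t = assms[THEN schwartz_imp_tempered]
  have d1: "deriv (\<lambda>x. 1/2 * (p x * r x)) = (\<lambda>x. 1/2 * (deriv p x * r x + p x * deriv r x))"
    by (rule ext, rule DERIV_imp_deriv, rule DERIV_cong, (rule derivative_intros tempered_DERIV tempered_deriv t)+) algebra
  have d2: "deriv (\<lambda>x. 1/2 * (deriv p x * r x + p x * deriv r x))
      = (\<lambda>x. 1/2 * (deriv (deriv p) x * r x + 2 * deriv p x * deriv r x + p x * deriv (deriv r) x))"
    by (rule ext, rule DERIV_imp_deriv, rule DERIV_cong, (rule derivative_intros tempered_DERIV tempered_deriv t)+) algebra
  have v': "deriv (\<lambda>x. - deriv (deriv q) x) = (\<lambda>x. - deriv (deriv (deriv q)) x)" if "q \<in> tempered" for q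
    by (rule ext, rule DERIV_imp_deriv, (rule derivative_intros tempered_DERIV tempered_deriv that)+)
  show ?thesis
    unfolding K1_covector_def d1 d2 density_Omega_adj_def v'[OF t(2)] v'[OF t(3)] deriv_const
  proof (intro conjI allI)
    show "((\<lambda>x. p x * deriv r x - deriv p x * r x) has_real_derivative
        - deriv (deriv p) x * r x - - deriv (deriv r) x * p x) (at x)" for x
      by (rule DERIV_cong, (rule derivative_intros tempered_DERIV tempered_deriv t)+) algebra
    show "((\<lambda>x. 1/2 * (deriv (deriv p) x * r x + 2 * deriv p x * deriv r x + p x * deriv (deriv r) x)) has_real_derivative
        - u x * 0 - 3/2 * - deriv (deriv p) x * deriv r x - 1/2 * - deriv (deriv (deriv p)) x * r x
        - 3/2 * - deriv (deriv r) x * deriv p x - 1/2 * - deriv (deriv (deriv r)) x * p x) (at x)" for x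
      by (rule DERIV_cong, (rule derivative_intros tempered_DERIV tempered_deriv t)+) algebra
  qed (intro schwartz_intros tempered_deriv assms t)+
qed

lemma flow_H1:
  assumes "u \<in> schwartz" "p \<in> schwartz" "r \<in> schwartz"
  shows "var_deriv H1 (state u p r) \<in> K1_domain (state u p r)"
    "K1 (state u p r) (var_deriv H1 (state u p r)) = limit_flow u p r"
proof -
  note t = assms[THEN schwartz_imp_tempered]
  note g = has_var_deriv_H1[OF assms]
  let ?v = "\<lambda>x. - deriv (deriv p) x" and ?w = "\<lambda>x. - deriv (deriv r) x"
  let ?F = "\<lambda>x. p x * deriv r x - deriv p x * r x" and ?f = "\<lambda>x. 1/2 * (p x * r x)"
  note K = K1_covector_H1[OF assms]
  have vw: "?v \<in> schwartz" "?w \<in> schwartz" by (intro schwartz_uminus schwartz_deriv assms)+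
  have F: "(\<lambda>x. ?v x * r x - ?w x * p x) = deriv ?F"
    using K1_covectorD(6)[OF K] by (intro ext DERIV_imp_deriv[symmetric])
  have f: "(deriv ^^ 3) ?f = density_Omega_adj u ?v ?w (\<lambda>x. 0) r p"
    using K1_covectorD(7)[OF K] by (auto simp: numeral_3_eq_3 intro!: DERIV_imp_deriv)
  have "Omega_adj (state u p r) (vec3 (\<lambda>x. 0) r p) = density_Omega_adj u ?v ?w (\<lambda>x. 0) r p"
    by (intro Omega_adj_vec3 vw t)
  with f have "Omega_adj (state u p r) (vec3 (\<lambda>x. 0) r p) = (deriv ^^ 3) ?f" by simp
  then have "vec3 (\<lambda>x. 0) r p \<in> K1_domain (state u p r)"
    using g F K1_covectorD(4,5)[OF K] unfolding K1_domain_def has_var_deriv_def mem_Collect_eq comp_vec3 by blast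
  then show "var_deriv H1 (state u p r) \<in> K1_domain (state u p r)" unfolding var_deriv_eq[OF g] .
  have d: "deriv (\<lambda>x. u x * p x * r x) x = deriv u x * p x * r x + u x * deriv p x * r x + u x * p x * deriv r x" for x
    by (rule DERIV_imp_deriv, rule DERIV_cong, (rule derivative_intros tempered_DERIV tempered_deriv t)+) algebra
  have f': "deriv ?f x = 1/2 * (deriv p x * r x + p x * deriv r x)" for x
    by (rule DERIV_imp_deriv, rule DERIV_cong, (rule derivative_intros tempered_DERIV tempered_deriv t)+) algebra
  have v': "deriv (\<lambda>x. - deriv (deriv q) x) x = - deriv (deriv (deriv q)) x" if "q \<in> tempered" for q x
    by (rule DERIV_imp_deriv, (rule derivative_intros tempered_DERIV tempered_deriv that)+)
  show "K1 (state u p r) (var_deriv H1 (state u p r)) = limit_flow u p r"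
    unfolding var_deriv_eq[OF g] K1_covector_K1[OF K assms(1) vw] K1_value_def limit_flow_def vec3_eq_iff
      d f' v'[OF t(2)] v'[OF t(3)]
    by (intro conjI ext) (simp_all add: field_simps)
qed

text \<open>The second derivatives in \<open>J1\<close> undo \<open>pinv 2\<close>, so v is driven
  by the derivative of \<open>H2\<close> with respect to r, and w by minus the one with respect to
  p.\<close>

lemma flow_H2:
  assumes "u \<in> schwartz" "p \<in> schwartz" "r \<in> schwartz"
  shows "J1 (state u p r) (var_deriv H2 (state u p r)) = limit_flow u p r"
proof -
  note t = assms[THEN schwartz_imp_tempered]
  have d: "deriv (\<lambda>x. u x * p x * r x) x = deriv u x * p x * r x + u x * deriv p x * r x + u x * p x * deriv r x" for x
    by (rule DERIV_imp_deriv, rule DERIV_cong, (rule derivative_intros tempered_DERIV tempered_deriv t)+) algebra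
  have d2: "deriv (\<lambda>x. - 2 * u x * p x * r x) x
      = - 2 * (deriv u x * p x * r x + u x * deriv p x * r x + u x * p x * deriv r x)" for x
    by (rule DERIV_imp_deriv, rule DERIV_cong, (rule derivative_intros tempered_DERIV tempered_deriv t)+) algebra
  show ?thesis
    unfolding var_deriv_eq[OF has_var_deriv_H2[OF assms]] J1_vec3 limit_flow_def vec3_eq_iff d d2
      deriv_deriv_pinv2[OF schwartz_uminus[OF H2_grad_schwartz(1)[OF assms]]]
      deriv_deriv_pinv2[OF schwartz_uminus[OF H2_grad_schwartz(2)[OF assms]]]
    unfolding H2_grad_p_def H2_grad_r_def
    by (intro conjI ext) (simp_all add: algebra_simps)
qed

text \<open>Stated for an arbitrary operator and functional whose vector field is
  \<open>limit_flow\<close>, so that both Hamiltonian forms are instances. Each time in T is treated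
  separately.\<close>

lemma limit_system_iff_flow:
  assumes S: "\<And>t f. t \<in> T \<Longrightarrow> f \<in> {u, p, r} \<Longrightarrow> (\<lambda>x. f (x, t)) \<in> schwartz"
    and P: "\<And>U p r. U \<in> schwartz \<Longrightarrow> p \<in> schwartz \<Longrightarrow> r \<in> schwartz \<Longrightarrow>
      P (state U p r) (var_deriv H (state U p r)) = limit_flow U p r"
  shows "limit_system (UNIV \<times> T) u v w p r \<longleftrightarrow> potentials (UNIV \<times> T) v w p r \<and> hamiltonian_flow P H T u v w"
proof (cases "potentials (UNIV \<times> T) v w p r")
  case True
  have "state_at (Dt u) (Dt v) (Dt w) t = P (state_at u v w t) (var_deriv H (state_at u v w t)) \<longleftrightarrow>
    (\<forall>x. Dt u (x, t) + Dx (\<lambda>y. u y * p y * r y) (x, t) = 0 \<and>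
        Dt v (x, t) + 3 * v (x, t) * Dx p (x, t) * r (x, t) + Dx v (x, t) * p (x, t) * r (x, t) + (u (x, t))\<^sup>2 * p (x, t) = 0 \<and>
        Dt w (x, t) + 3 * w (x, t) * p (x, t) * Dx r (x, t) + Dx w (x, t) * p (x, t) * r (x, t) - (u (x, t))\<^sup>2 * r (x, t) = 0)"
    if t: "t \<in> T" for t
  proof -
    let ?u = "\<lambda>x. u (x, t)" and ?p = "\<lambda>x. p (x, t)" and ?r = "\<lambda>x. r (x, t)"
    have s: "?u \<in> schwartz" "?p \<in> schwartz" "?r \<in> schwartz" using S[OF t] by auto
    have vw: "(\<lambda>x. v (x, t)) = (\<lambda>x. - deriv (deriv ?p) x)" "(\<lambda>x. w (x, t)) = (\<lambda>x. - deriv (deriv ?r) x)"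
      using True t unfolding potentials_def by (auto simp: Dx_def fun_eq_iff)
    have U: "state_at u v w t = state ?u ?p ?r" unfolding state_at_def vw ..
    have "Dx v (x, t) = deriv (\<lambda>x. - deriv (deriv ?p) x) x" "Dx w (x, t) = deriv (\<lambda>x. - deriv (deriv ?r) x) x" for x
      by (simp_all add: Dx_def vw)
    moreover have "deriv (\<lambda>x. - deriv (deriv q) x) x = - deriv (deriv (deriv q)) x" if "q \<in> schwartz" for q x
      by (rule DERIV_imp_deriv, (rule derivative_intros tempered_DERIV tempered_deriv schwartz_imp_tempered[OF that])+)
    ultimately have d: "Dx v (x, t) = - deriv (deriv (deriv ?p)) x" "Dx w (x, t) = - deriv (deriv (deriv ?r)) x" for x
      using s by simp_all
    have e: "v (x, t) = - deriv (deriv ?p) x" "w (x, t) = - deriv (deriv ?r) x" for x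
      using vw by meson+
    show ?thesis
      unfolding U
      unfolding P[OF s]
      unfolding limit_flow_def state_at_def vec3_eq_iff
      unfolding fun_eq_iff d e
      by (auto simp: Dx_def algebra_simps eq_neg_iff_add_eq_0)
  qed
  then show ?thesis using True unfolding limit_system_def hamiltonian_flow_def by auto
next
  case False
  then show ?thesis by (simp add: limit_system_def)
qed

section \<open>The Lax pair\<close>

lemma C_inf_on_D:
  assumes "C_inf_on D f"
  shows "f differentiable_on D" "C_inf_on D (Dx f)" "C_inf_on D (Dt f)"
proof -
  show "f differentiable_on D"
    using assms[unfolded C_inf_on_def, rule_format, of "[]"] by simp
  \<comment> \<open>\<open>foldr\<close> applies the last entry first, so appending E means
    differentiating by E before ds.\<close>
  have "foldr (\<lambda>d g. d g) ds (E f) differentiable_on D" if "set ds \<subseteq> {Dx, Dt}" "E \<in> {Dx, Dt}" for ds E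
    using assms[unfolded C_inf_on_def, rule_format, of "ds @ [E]"] that by simp
  then show "C_inf_on D (Dx f)" "C_inf_on D (Dt f)"
    unfolding C_inf_on_def by blast+
qed

lemma C_inf_on_DERIV:
  assumes "C_inf_on D f" "open D" "(x, t) \<in> D"
  shows "((\<lambda>y. f (y, t)) has_real_derivative Dx f (x, t)) (at x)"
    "((\<lambda>s. f (x, s)) has_real_derivative Dt f (x, t)) (at t)"
proof -
  have d: "f differentiable at (x, t)"
    using C_inf_on_D(1)[OF assms(1)] assms(3) unfolding differentiable_on_def at_within_open[OF assms(3,2), symmetric]
    by blast
  have "(\<lambda>y. (y, t)) differentiable at x" "(\<lambda>s. (x, s)) differentiable at t"
    by (rule differentiableI, rule has_derivative_Pair, (rule has_derivative_ident has_derivative_const)+)+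
  then have "f \<circ> (\<lambda>y. (y, t)) differentiable at x" "f \<circ> (\<lambda>s. (x, s)) differentiable at t"
    using d by (auto intro: differentiable_chain_at)
  then have "(\<lambda>y. f (y, t)) differentiable at x" "(\<lambda>s. f (x, s)) differentiable at t"
    unfolding o_def .
  then show "((\<lambda>y. f (y, t)) has_real_derivative Dx f (x, t)) (at x)"
    "((\<lambda>s. f (x, s)) has_real_derivative Dt f (x, t)) (at t)"
    by (simp_all add: Dx_def Dt_def DERIV_deriv_iff_real_differentiable)
qed

section \<open>Derivatives of matrix-valued functions, and the curvature\<close>

lemma has_vector_derivative_vec:
  fixes f :: "real \<Rightarrow> 'a::real_normed_vector ^ 'n"
  assumes "\<And>i. ((\<lambda>x. f x $ i) has_vector_derivative f' $ i) (at x)"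
  shows "(f has_vector_derivative f') (at x)"
  unfolding has_vector_derivative_def has_derivative_at_within
proof (intro conjI bounded_linear_scaleR_left vec_tendstoI)
  fix i
  show "((\<lambda>y. ((f y - f x - (y - x) *\<^sub>R f') /\<^sub>R norm (y - x)) $ i) \<longlongrightarrow> 0 $ i) (at x)"
    using assms[of i] by (simp add: has_vector_derivative_def has_derivative_at_within)
qed

lemma has_vector_derivative_vector_3:
  fixes a b c :: "real \<Rightarrow> 'a::real_normed_vector"
  assumes "(a has_vector_derivative a') (at x)" "(b has_vector_derivative b') (at x)"
    "(c has_vector_derivative c') (at x)"
  shows "((\<lambda>y. vector [a y, b y, c y] :: 'a ^ 3) has_vector_derivative vector [a', b', c']) (at x)"
proof (rule has_vector_derivative_vec)
  have "\<forall>i::3. ((\<lambda>y. (vector [a y, b y, c y] :: 'a ^ 3) $ i) has_vector_derivative (vector [a', b', c'] :: 'a ^ 3) $ i) (at x)"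
    unfolding forall_3 using assms by simp
  then show "((\<lambda>y. (vector [a y, b y, c y] :: 'a ^ 3) $ i) has_vector_derivative (vector [a', b', c'] :: 'a ^ 3) $ i) (at x)" for i
    by blast
qed

text \<open>Functions and their derivatives are independent complex numbers here, which makes this a
  rational identity. The first two matrices are the t-derivative of \<open>Lax_U\<close> and the
  x-derivative of \<open>Lax_V\<close>; the right-hand side is grouped by the residuals of the
  equations of the system and of pxx + v, rxx + w.\<close>

lemma curvature_matrix:
  fixes u v w p r ut vt wt ux vx wx px rx pxx rxx l :: complex
  assumes "l \<noteq> 0"
  shows "vector [vector [0, 0, 0], vector [l * (2 * u * ut), 0, vt], vector [l * wt, 0, 0]]
    - vector [vector [px * rx + p * rxx, - (px * r + p * rx), px / l],
              vector [pxx * rx + px * rxx - l * (2 * u * ux * p * r + u\<^sup>2 * (px * r + p * rx)), - (pxx * r + px * rx),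
                      pxx / l - (vx * p * r + v * (px * r + p * rx))],
              vector [- l * (wx * p * r + w * (px * r + p * rx)) - rxx, rx, pxx * r - p * rxx]]
    + (vector [vector [0, 1, 0], vector [l * u\<^sup>2, 0, v], vector [l * w, 0, 0]] :: complex ^ 3 ^ 3) **
      vector [vector [1 / (3 * l) + p * rx, - p * r, p / l],
             vector [px * rx - l * u\<^sup>2 * p * r, 1 / (3 * l) - px * r, px / l - v * p * r],
             vector [- l * w * p * r - rx, r, px * r - p * rx - 2 / (3 * l)]]
    - (vector [vector [1 / (3 * l) + p * rx, - p * r, p / l],
             vector [px * rx - l * u\<^sup>2 * p * r, 1 / (3 * l) - px * r, px / l - v * p * r],
             vector [- l * w * p * r - rx, r, px * r - p * rx - 2 / (3 * l)]] :: complex ^ 3 ^ 3) **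
      vector [vector [0, 1, 0], vector [l * u\<^sup>2, 0, v], vector [l * w, 0, 0]]
   = (vector [vector [- p * (rxx + w), 0, 0],
         vector [2 * l * u * (ut + (ux * p * r + u * px * r + u * p * rx)) - rx * (pxx + v) - px * (rxx + w),
                 r * (pxx + v),
                 (vt + 3 * v * px * r + vx * p * r + u\<^sup>2 * p) - (pxx + v) / l],
         vector [l * (wt + 3 * w * p * rx + wx * p * r - u\<^sup>2 * r) + (rxx + w), 0,
                 p * (rxx + w) - r * (pxx + v)]] :: complex ^ 3 ^ 3)"
  using assms
  by (simp add: vec_eq_iff forall_3 matrix_matrix_mult_def sum_3 field_simps power2_eq_square)

lemma zero_curvature_entries:
  assumes D: "open D" and u: "C_inf_on D u" and v: "C_inf_on D v" and w: "C_inf_on D w"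
    and p: "C_inf_on D p" and r: "C_inf_on D r" and l: "l \<noteq> 0" and z: "z \<in> D"
  defines "A \<equiv> Dx (Dx p) z + v z" and "B \<equiv> Dx (Dx r) z + w z"
    and "Eu \<equiv> Dt u z + Dx (\<lambda>y. u y * p y * r y) z"
    and "Ev \<equiv> Dt v z + 3 * v z * Dx p z * r z + Dx v z * p z * r z + (u z)\<^sup>2 * p z"
    and "Ew \<equiv> Dt w z + 3 * w z * p z * Dx r z + Dx w z * p z * r z - (u z)\<^sup>2 * r z"
  shows "vector_derivative (\<lambda>s. Lax_U u v w l (fst z, s)) (at (snd z))
     - vector_derivative (\<lambda>y. Lax_V u v w p r l (y, snd z)) (at (fst z))
     + Lax_U u v w l z ** Lax_V u v w p r l z - Lax_V u v w p r l z ** Lax_U u v w l z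
   = vector [vector [- of_real (p z) * of_real B, 0, 0],
         vector [2 * l * of_real (u z) * of_real Eu - of_real (Dx r z) * of_real A - of_real (Dx p z) * of_real B,
                 of_real (r z) * of_real A, of_real Ev - of_real A / l],
         vector [l * of_real Ew + of_real B, 0, of_real (p z) * of_real B - of_real (r z) * of_real A]]"
proof -
  obtain x t where zx: "z = (x, t)" by (cases z)
  note in_D = z[unfolded zx]
  note X = C_inf_on_DERIV(1)[OF _ D in_D] and T = C_inf_on_DERIV(2)[OF _ D in_D]
  note p' = C_inf_on_D(2)[OF p] and r' = C_inf_on_D(2)[OF r]
  let ?c = "\<lambda>f. complex_of_real (f (x, t))"
  have Ut: "vector_derivative (\<lambda>s. Lax_U u v w l (x, s)) (at t)
    = vector [vector [0, 0, 0], vector [l * (2 * ?c u * ?c (Dt u)), 0, ?c (Dt v)], vector [l * ?c (Dt w), 0, 0]]"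
    unfolding Lax_U_def Let_def
    by (rule vector_derivative_at, intro has_vector_derivative_vector_3)
       (auto intro!: derivative_eq_intros T u v w simp: power2_eq_square algebra_simps)
  have Vx: "vector_derivative (\<lambda>y. Lax_V u v w p r l (y, t)) (at x)
    = vector [vector [?c (Dx p) * ?c (Dx r) + ?c p * ?c (Dx (Dx r)), - (?c (Dx p) * ?c r + ?c p * ?c (Dx r)), ?c (Dx p) / l],
              vector [?c (Dx (Dx p)) * ?c (Dx r) + ?c (Dx p) * ?c (Dx (Dx r))
                 - l * (2 * ?c u * ?c (Dx u) * ?c p * ?c r + (?c u)\<^sup>2 * (?c (Dx p) * ?c r + ?c p * ?c (Dx r))),
                 - (?c (Dx (Dx p)) * ?c r + ?c (Dx p) * ?c (Dx r)),
                 ?c (Dx (Dx p)) / l - (?c (Dx v) * ?c p * ?c r + ?c v * (?c (Dx p) * ?c r + ?c p * ?c (Dx r)))],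
              vector [- l * (?c (Dx w) * ?c p * ?c r + ?c w * (?c (Dx p) * ?c r + ?c p * ?c (Dx r))) - ?c (Dx (Dx r)),
                 ?c (Dx r), ?c (Dx (Dx p)) * ?c r - ?c p * ?c (Dx (Dx r))]]"
    unfolding Lax_V_def Let_def
    by (rule vector_derivative_at, intro has_vector_derivative_vector_3)
       (auto intro!: derivative_eq_intros X u v w p r p' r' simp: power2_eq_square algebra_simps)
  have "Dx (\<lambda>y. u y * p y * r y) (x, t)
      = Dx u (x, t) * p (x, t) * r (x, t) + u (x, t) * Dx p (x, t) * r (x, t) + u (x, t) * p (x, t) * Dx r (x, t)"
    unfolding Dx_def[of "\<lambda>y. u y * p y * r y"] prod.case
    by (rule DERIV_imp_deriv, rule DERIV_cong, (rule derivative_intros C_inf_on_DERIV(1)[OF _ D in_D] u p r)+) algebra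
  then show ?thesis
    unfolding zx fst_conv snd_conv Ut Vx
    unfolding Lax_U_def Lax_V_def Let_def curvature_matrix[OF l] A_def B_def Eu_def Ev_def Ew_def zx
    by simp
qed

lemma transport_eq_0_of_mult_eq_0:
  assumes D: "open D" and u: "C_inf_on D u" and p: "C_inf_on D p" and r: "C_inf_on D r"
    and 0: "\<And>z. z \<in> D \<Longrightarrow> u z * (Dt u z + Dx (\<lambda>y. u y * p y * r y) z) = 0" and z: "z \<in> D"
  shows "Dt u z + Dx (\<lambda>y. u y * p y * r y) z = 0"
proof (rule ccontr)
  \<comment> \<open>Expanded by the product rule, the expression is visibly continuous on D.\<close>
  define E where "E z = Dt u z + (Dx u z * p z * r z + u z * Dx p z * r z + u z * p z * Dx r z)" for z
  have E: "Dt u y + Dx (\<lambda>y. u y * p y * r y) y = E y" if "y \<in> D" for y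
  proof -
    obtain x t where y: "y = (x, t)" by (cases y)
    show ?thesis
      unfolding y E_def Dx_def[of "\<lambda>y. u y * p y * r y"] prod.case add_left_cancel
      by (rule DERIV_imp_deriv, rule DERIV_cong,
          (rule derivative_intros C_inf_on_DERIV(1)[OF _ D that[unfolded y]] u p r)+) algebra
  qed
  define W where "W = {y \<in> D. E y \<noteq> 0}"
  have c: "continuous_on D f" if "C_inf_on D f" for f
    using C_inf_on_D(1)[OF that] by (rule differentiable_imp_continuous_on)
  have "continuous_on D E"
    unfolding E_def[abs_def]
    by (intro continuous_intros c C_inf_on_D(2,3)[OF u] C_inf_on_D(2)[OF p] C_inf_on_D(2)[OF r] u p r)
  then have "open W"
    using continuous_open_preimage[OF _ D, of E "- {0}"] unfolding W_def vimage_def Int_def by (simp add: open_Compl)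
  assume "Dt u z + Dx (\<lambda>y. u y * p y * r y) z \<noteq> 0"
  then have "z \<in> W" using E[OF z] z by (simp add: W_def)
  have u0: "u y = 0" if "y \<in> W" for y
    using 0[of y] E[of y] that by (auto simp: W_def)
  obtain x t where zx: "z = (x, t)" by (cases z)
  have "\<forall>\<^sub>F y in nhds x. (y, t) \<in> W" "\<forall>\<^sub>F s in nhds t. (x, s) \<in> W"
    using \<open>z \<in> W\<close> \<open>open W\<close> unfolding zx
    by (auto intro!: topological_tendstoD[of _ "(x, t)"] tendsto_Pair filterlim_ident tendsto_const)
  then have "\<forall>\<^sub>F y in nhds x. u (y, t) = 0" "\<forall>\<^sub>F s in nhds t. u (x, s) = 0"
    using u0 by (auto elim: eventually_mono)
  then have "Dx u (x, t) = 0" "Dt u (x, t) = 0"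
    unfolding Dx_def Dt_def prod.case by (simp_all add: deriv_cong_ev[of _ "\<lambda>_. 0"])
  \<comment> \<open>Every term of E contains u or one of its first partial derivatives as a
    factor.\<close>
  then have "E z = 0" using u0[OF \<open>z \<in> W\<close>] unfolding E_def zx by simp
  with \<open>z \<in> W\<close> show False by (simp add: W_def)
qed

lemma Lax_pair:
  assumes D: "open D" and u: "C_inf_on D u" and v: "C_inf_on D v" and w: "C_inf_on D w"
    and p: "C_inf_on D p" and r: "C_inf_on D r"
  shows "is_Lax_pair D (limit_system D u v w p r) (Lax_U u v w) (Lax_V u v w p r)"
  unfolding is_Lax_pair_def
proof
  note entries = zero_curvature_entries[OF D u v w p r]
  have zc: "zero_curvature D (Lax_U u v w l) (Lax_V u v w p r l) \<longleftrightarrow>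
     (\<forall>z\<in>D. vector_derivative (\<lambda>s. Lax_U u v w l (fst z, s)) (at (snd z))
       - vector_derivative (\<lambda>y. Lax_V u v w p r l (y, snd z)) (at (fst z))
       + Lax_U u v w l z ** Lax_V u v w p r l z - Lax_V u v w p r l z ** Lax_U u v w l z = 0)" for l
    unfolding zero_curvature_def by (auto simp: case_prod_beta)
  {
    assume sys: "limit_system D u v w p r"
    show "\<forall>l. l \<noteq> 0 \<longrightarrow> zero_curvature D (Lax_U u v w l) (Lax_V u v w p r l)"
      unfolding zc
    proof (intro allI impI ballI)
      fix l :: complex and z assume l: "l \<noteq> 0" and z: "z \<in> D"
      have "Dx (Dx p) z + v z = 0" "Dx (Dx r) z + w z = 0"
        "Dt u z + Dx (\<lambda>y. u y * p y * r y) z = 0"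
        "Dt v z + 3 * v z * Dx p z * r z + Dx v z * p z * r z + (u z)\<^sup>2 * p z = 0"
        "Dt w z + 3 * w z * p z * Dx r z + Dx w z * p z * r z - (u z)\<^sup>2 * r z = 0"
        using sys z unfolding limit_system_def potentials_def by auto
      then show "vector_derivative (\<lambda>s. Lax_U u v w l (fst z, s)) (at (snd z))
         - vector_derivative (\<lambda>y. Lax_V u v w p r l (y, snd z)) (at (fst z))
         + Lax_U u v w l z ** Lax_V u v w p r l z - Lax_V u v w p r l z ** Lax_U u v w l z = 0"
        unfolding entries[OF l z] by (simp only:) (simp add: vec_eq_iff forall_3)
    qed
  }
  assume "\<forall>l. l \<noteq> 0 \<longrightarrow> zero_curvature D (Lax_U u v w l) (Lax_V u v w p r l)"
  then have lax: "vector_derivative (\<lambda>s. Lax_U u v w l (fst z, s)) (at (snd z))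
       - vector_derivative (\<lambda>y. Lax_V u v w p r l (y, snd z)) (at (fst z))
       + Lax_U u v w l z ** Lax_V u v w p r l z - Lax_V u v w p r l z ** Lax_U u v w l z = 0"
    if "l \<noteq> 0" "z \<in> D" for l z
    using that unfolding zc by blast
  let ?A = "\<lambda>z. Dx (Dx p) z + v z" and ?B = "\<lambda>z. Dx (Dx r) z + w z"
    and ?Eu = "\<lambda>z. Dt u z + Dx (\<lambda>y. u y * p y * r y) z"
    and ?Ev = "\<lambda>z. Dt v z + 3 * v z * Dx p z * r z + Dx v z * p z * r z + (u z)\<^sup>2 * p z"
    and ?Ew = "\<lambda>z. Dt w z + 3 * w z * p z * Dx r z + Dx w z * p z * r z - (u z)\<^sup>2 * r z"
  have eqs: "?Ev z - ?A z / l = 0" "l * ?Ew z + ?B z = 0"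
     "2 * l * u z * ?Eu z - Dx r z * ?A z - Dx p z * ?B z = 0" if "l \<noteq> 0" "z \<in> D" for l :: real and z
  proof -
    have "of_real l \<noteq> (0 :: complex)" using that(1) by simp
    note e = lax[OF this that(2), unfolded entries[OF this that(2)], unfolded vec_eq_iff forall_3 vector_3 zero_index]
    have "complex_of_real (?Ev z - ?A z / l) = 0" using e by simp
    then show "?Ev z - ?A z / l = 0" unfolding of_real_eq_0_iff .
    have "complex_of_real (l * ?Ew z + ?B z) = 0" using e by simp
    then show "l * ?Ew z + ?B z = 0" unfolding of_real_eq_0_iff .
    have "complex_of_real (2 * l * u z * ?Eu z - Dx r z * ?A z - Dx p z * ?B z) = 0" using e by simp
    then show "2 * l * u z * ?Eu z - Dx r z * ?A z - Dx p z * ?B z = 0" unfolding of_real_eq_0_iff .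
  qed
  have AB: "?A z = 0" "?B z = 0" "?Ev z = 0" "?Ew z = 0" if "z \<in> D" for z
  proof -
    \<comment> \<open>Each of these entries is affine in 1/\<lambda> or in \<lambda>, so the values
      1 and 2 already separate its two coefficients.\<close>
    have "e - a / 1 = 0 \<Longrightarrow> e - a / 2 = 0 \<Longrightarrow> a = 0 \<and> e = 0" for a e :: real by simp
    from this[OF eqs(1)[of 1, OF _ that] eqs(1)[of 2, OF _ that]] show "?A z = 0" "?Ev z = 0" by simp_all
    have "1 * e + b = 0 \<Longrightarrow> 2 * e + b = 0 \<Longrightarrow> b = 0 \<and> e = 0" for b e :: real by simp
    from this[OF eqs(2)[of 1, OF _ that] eqs(2)[of 2, OF _ that]] show "?B z = 0" "?Ew z = 0" by simp_all
  qed
  have "u z * ?Eu z = 0" if "z \<in> D" for z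
    using eqs(3)[of 1, OF _ that] AB(1,2)[OF that] by simp
  then have Eu: "?Eu z = 0" if "z \<in> D" for z
    using transport_eq_0_of_mult_eq_0[OF D u p r _ that] by blast
  have "v z = - Dx (Dx p) z" "w z = - Dx (Dx r) z" if "z \<in> D" for z
    using AB(1,2)[OF that] by linarith+
  then show "limit_system D u v w p r"
    unfolding limit_system_def potentials_def using AB(3,4) Eu by blast
qed

theorem mainTheorem9:
  shows "bi_hamiltonian_pair (\<lambda>U. covectors) J1 K1_domain K1 \<and>
    (\<forall>U\<in>states.
       (\<exists>!g. has_var_deriv H2 U g) \<and> (\<exists>!g. has_var_deriv H1 U g) \<and>
       var_deriv H1 U \<in> K1_domain U \<and>
       J1 U (var_deriv H2 U) = K1 U (var_deriv H1 U)) \<and>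
    (\<forall>I T u v w p r.
       open I \<and> T \<subseteq> I \<and> (\<forall>f\<in>{u, v, w, p, r}. C_inf_on (UNIV \<times> I) f) \<and>
       (\<forall>t\<in>T. \<forall>f\<in>{u, p, r}. (\<lambda>x. f (x, t)) \<in> schwartz) \<longrightarrow>
       (limit_system (UNIV \<times> T) u v w p r \<longleftrightarrow>
          potentials (UNIV \<times> T) v w p r \<and> hamiltonian_flow J1 H2 T u v w) \<and>
       (limit_system (UNIV \<times> T) u v w p r \<longleftrightarrow>
          potentials (UNIV \<times> T) v w p r \<and> hamiltonian_flow K1 H1 T u v w)) \<and>
    (\<forall>D u v w p r.
       open D \<and> (\<forall>f\<in>{u, v, w, p, r}. C_inf_on D f) \<longrightarrow>
       is_Lax_pair D (limit_system D u v w p r) (Lax_U u v w) (Lax_V u v w p r))"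
proof (intro conjI ballI allI impI)
  show "bi_hamiltonian_pair (\<lambda>U. covectors) J1 K1_domain K1"
    by (rule bi_hamiltonian_pair_J1_K1)
next
  fix U assume "U \<in> states"
  then obtain u p r where U: "U = state u p r" and s: "u \<in> schwartz" "p \<in> schwartz" "r \<in> schwartz"
    by (rule statesE)
  show "\<exists>!g. has_var_deriv H2 U g" "\<exists>!g. has_var_deriv H1 U g"
    using has_var_deriv_H2[OF s] has_var_deriv_H1[OF s] has_var_deriv_unique unfolding U by blast+
  show "var_deriv H1 U \<in> K1_domain U" "J1 U (var_deriv H2 U) = K1 U (var_deriv H1 U)"
    unfolding U flow_H2[OF s] flow_H1(2)[OF s] using flow_H1(1)[OF s] by simp_all
next
  fix I T u v w p r
  assume "open I \<and> T \<subseteq> I \<and> (\<forall>f\<in>{u, v, w, p, r}. C_inf_on (UNIV \<times> I) f) \<and>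
       (\<forall>t\<in>T. \<forall>f\<in>{u, p, r}. (\<lambda>x. f (x, t)) \<in> schwartz)"
  then have S: "\<And>t f. t \<in> T \<Longrightarrow> f \<in> {u, p, r} \<Longrightarrow> (\<lambda>x. f (x, t)) \<in> schwartz" by blast
  show "limit_system (UNIV \<times> T) u v w p r \<longleftrightarrow>
          potentials (UNIV \<times> T) v w p r \<and> hamiltonian_flow J1 H2 T u v w"
    using S flow_H2 by (rule limit_system_iff_flow)
  show "limit_system (UNIV \<times> T) u v w p r \<longleftrightarrow>
          potentials (UNIV \<times> T) v w p r \<and> hamiltonian_flow K1 H1 T u v w"
    using S flow_H1(2) by (rule limit_system_iff_flow)
next
  fix D u v w p r
  assume "open D \<and> (\<forall>f\<in>{u, v, w, p, r}. C_inf_on D f)"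
  then show "is_Lax_pair D (limit_system D u v w p r) (Lax_U u v w) (Lax_V u v w p r)"
    by (intro Lax_pair) auto
qed

end
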